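(* Let $\gamma>0$ and let $g(x):=e_{q^2}(-x^2)=1/(-x^2;q^2)_\infty$ (regarded as a function on $L(\gamma)$ and on the strip $|{\rm Im}(x)|<1$). Let $f\in\mathcal H^{\rm S}\mathcal I_{\gamma,>1/2}^{\rm s\omega}$ be an entire function, not identically zero. Then, for $n\in\mathbf Z$ sufficiently large, $(Q^{-n}f)*_\gamma g\ne g*_\gamma(Q^{-n}f)$, where $(Q^{-n}f)(x)=f(q^{-n}x)$.
   Context: Fix $0<q<1$. $(a;q)_\infty=\prod_{j\ge0}(1-aq^j)$, $[e]_q=\frac{1-q^e}{1-q}$, $[e]_q!=[1]_q\cdots[e]_q$. The $q$-derivative is $(\partial f)(x)=\frac{f(x)-f(qx)}{(1-q)x}$ for $x\ne0$; for functions holomorphic near $0$ its value at $0$ is given by analytic continuation. For $\gamma>0$ let $L(\gamma)=\{\pm q^k\gamma\mid k\in\mathbf Z\}$ and $\int_\gamma f=(1-q)\sum_{k\in\mathbf Z}\sum_{\epsilon=\pm1}q^k\gamma f(\epsilon q^k\gamma)$ when the sum converges absolutely. $\mathcal I_\gamma^\infty$ is the space of functions $f$ on $L(\gamma)$ such that for all $e\in\mathbf Z_{\ge0}$ this sum converges absolutely for $x\mapsto f(x)x^e$. For $f\in\mathcal I_\gamma^\infty$: $\mu_{e,\gamma}(f)=q^{(e^2+e)/2}\int_\gamma f(x)x^e$ and $\nu_{e,\gamma}(f)=q^{(e^2+e)/2}\int_\gamma|f(x)x^e|$. $q$-convolution: $(f*_\gamma g)(x)=\sum_{e=0}^\infty\frac{(-1)^e\mu_{e,\gamma}(f)}{[e]_q!}(\partial^e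 g)(x)$, at points $x$ where all $(\partial^eg)(x)$ are defined and the series converges absolutely. $\mathcal H^{\rm S}\mathcal I_{\gamma,>1/2}^{\rm s\omega}$ is the set of $f\in\mathcal I_\gamma^\infty$ such that, for some $\alpha\in(1/2,1]$ and $b>0$, $\nu_{e,\gamma}(f)=O(q^{\alpha e^2/2}b^e)$ as $e\to\infty$, and such that $f$ is the restriction to $L(\gamma)$ of a (necessarily unique) function holomorphic on some strip $\{|{\rm Im}(z)|<a\}$, $a>0$; that $f$ is entire means that this holomorphic function extends to an entire function, again denoted $f$. *)

theory Defs
  imports "HOL-Complex_Analysis.Complex_Analysis" "HOL-Library.Landau_Symbols"
begin

definition q_poch_inf :: "complex \<Rightarrow> real \<Rightarrow> complex" where
  "q_poch_inf a q = (\<Prod>j. 1 - a * of_real q ^ j)"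

definition q_exp :: "real \<Rightarrow> complex \<Rightarrow> complex" where
  "q_exp q z = 1 / q_poch_inf z q"

definition q_num :: "real \<Rightarrow> nat \<Rightarrow> real" where
  "q_num q e = (1 - q ^ e) / (1 - q)"

definition q_fact :: "real \<Rightarrow> nat \<Rightarrow> real" where
  "q_fact q e = (\<Prod>i=1..e. q_num q i)"

text \<open>
  Functions on the lattice are represented by total functions on the complex plane of which
  only the values on the lattice matter. The value of the q-derivative at 0 is meaningful
  for functions holomorphic near 0, where the limit is the analytic continuation.
\<close>

definition q_deriv :: "real \<Rightarrow> (complex \<Rightarrow> complex) \<Rightarrow> complex \<Rightarrow> complex" where
  "q_deriv q f x =
     (if x = 0 then Lim (at 0) (\<lambda>y. (f y - f (of_real q * y)) / ((1 - of_real q) * y))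
      else (f x - f (of_real q * x)) / ((1 - of_real q) * x))"

definition q_lattice :: "real \<Rightarrow> real \<Rightarrow> complex set" where
  "q_lattice q \<gamma> = {of_real (\<epsilon> * q powi k * \<gamma>) | \<epsilon> k. \<epsilon> \<in> {1, -1}}"

text \<open>The integrand is vector-valued, so that it can be complex (for the moments) or
  real (for the absolute moments).\<close>

definition q_integral_term ::
  "real \<Rightarrow> real \<Rightarrow> (complex \<Rightarrow> 'a::real_normed_vector) \<Rightarrow> int \<times> real \<Rightarrow> 'a" where
  "q_integral_term q \<gamma> f = (\<lambda>(k, \<epsilon>). (q powi k * \<gamma>) *\<^sub>R f (of_real (\<epsilon> * q powi k * \<gamma>)))"

definition q_integrable ::
  "real \<Rightarrow> real \<Rightarrow> (complex \<Rightarrow> 'a::real_normed_vector) \<Rightarrow> bool" where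
  "q_integrable q \<gamma> f \<longleftrightarrow> q_integral_term q \<gamma> f abs_summable_on (UNIV \<times> {1, -1})"

definition q_integral ::
  "real \<Rightarrow> real \<Rightarrow> (complex \<Rightarrow> 'a::real_normed_vector) \<Rightarrow> 'a" where
  "q_integral q \<gamma> f = (1 - q) *\<^sub>R infsum (q_integral_term q \<gamma> f) (UNIV \<times> {1, -1})"

definition I_inf :: "real \<Rightarrow> real \<Rightarrow> (complex \<Rightarrow> complex) set" where
  "I_inf q \<gamma> = {f. \<forall>e::nat. q_integrable q \<gamma> (\<lambda>x. f x * x ^ e)}"

definition q_moment :: "real \<Rightarrow> real \<Rightarrow> (complex \<Rightarrow> complex) \<Rightarrow> nat \<Rightarrow> complex" where
  "q_moment q \<gamma> f e = of_real (q ^ ((e\<^sup>2 + e) div 2)) * q_integral q \<gamma> (\<lambda>x. f x * x ^ e)"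

definition q_abs_moment :: "real \<Rightarrow> real \<Rightarrow> (complex \<Rightarrow> complex) \<Rightarrow> nat \<Rightarrow> real" where
  "q_abs_moment q \<gamma> f e = q ^ ((e\<^sup>2 + e) div 2) * q_integral q \<gamma> (\<lambda>x. cmod (f x * x ^ e))"

definition q_conv_term ::
  "real \<Rightarrow> real \<Rightarrow> (complex \<Rightarrow> complex) \<Rightarrow> (complex \<Rightarrow> complex) \<Rightarrow> complex \<Rightarrow> nat \<Rightarrow> complex" where
  "q_conv_term q \<gamma> f g x e =
     (-1) ^ e * q_moment q \<gamma> f e / of_real (q_fact q e) * (q_deriv q ^^ e) g x"

definition q_conv_converges ::
  "real \<Rightarrow> real \<Rightarrow> (complex \<Rightarrow> complex) \<Rightarrow> (complex \<Rightarrow> complex) \<Rightarrow> complex \<Rightarrow> bool" where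
  "q_conv_converges q \<gamma> f g x \<longleftrightarrow> summable (\<lambda>e. cmod (q_conv_term q \<gamma> f g x e))"

definition q_conv ::
  "real \<Rightarrow> real \<Rightarrow> (complex \<Rightarrow> complex) \<Rightarrow> (complex \<Rightarrow> complex) \<Rightarrow> complex \<Rightarrow> complex" where
  "q_conv q \<gamma> f g x = (\<Sum>e. q_conv_term q \<gamma> f g x e)"

definition HS_I_gt_half :: "real \<Rightarrow> real \<Rightarrow> (complex \<Rightarrow> complex) set" where
  "HS_I_gt_half q \<gamma> =
     {f \<in> I_inf q \<gamma>.
        (\<exists>\<alpha> b. 1/2 < \<alpha> \<and> \<alpha> \<le> 1 \<and> 0 < b \<and>
           (\<lambda>e. q_abs_moment q \<gamma> f e) \<in> O(\<lambda>e. q powr (\<alpha> * (real e)\<^sup>2 / 2) * b ^ e)) \<and>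
        (\<exists>a>0. \<exists>F. F holomorphic_on {z. \<bar>Im z\<bar> < a} \<and> (\<forall>x\<in>q_lattice q \<gamma>. f x = F x))}"

text \<open>The integral power \<open>Q\<^sup>m\<close> of the dilation \<open>(Q f)(x) = f (q x)\<close>.\<close>

definition q_dil :: "real \<Rightarrow> int \<Rightarrow> (complex \<Rightarrow> complex) \<Rightarrow> complex \<Rightarrow> complex" where
  "q_dil q m f x = f (of_real (q powi m) * x)"

text \<open>
  Inequality of the convolutions as functions on the lattice, which requires a point at which
  both series converge absolutely: a mere difference of the domains of convergence, or of the
  default value of a divergent series, does not count. At lattice points all iterated
  q-derivatives are defined.
\<close>

definition q_conv_differ ::
  "real \<Rightarrow> real \<Rightarrow> (complex \<Rightarrow> complex) \<Rightarrow> (complex \<Rightarrow> complex) \<Rightarrow> bool" where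
  "q_conv_differ q \<gamma> f g \<longleftrightarrow>
     (\<exists>x\<in>q_lattice q \<gamma>. q_conv_converges q \<gamma> f g x \<and> q_conv_converges q \<gamma> g f x \<and>
        q_conv q \<gamma> f g x \<noteq> q_conv q \<gamma> g f x)"

end

(*
  Let phi(x) = (-x^2;q^2)_oo, so that g = 1/phi, and let h = Q^{-n} f. From g(qx) = (1 + x^2) g(x) one
  gets (1-q)^e d^e g = G_e g with polynomials G_e, hence h * g = P g on the lattice with P holomorphic,
  while g * h = E is holomorphic since h is entire. If the two convolutions agreed on the lattice,
  which accumulates at 0, then P = E phi by the identity theorem, and P(i) = 0 because phi(i) = 0.
  But G_e(i) = (-i)^e, so P(i) is, up to the factor q^n, a power series in q^n whose coefficients are
  nonzero multiples of the moments of f. It vanishes for arbitrarily large n only if all moments of f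
  vanish, and in the class considered (alpha > 1/2) that forces f = 0 on the lattice, hence f = 0.
*)
theory Submission imports Defs begin

text \<open>The point \<i> is a pole of g nearest to 0, on the boundary of the strip where g is
  holomorphic. A nonzero P(\<i>) means that P g keeps this pole, while E is regular there because h
  is entire. Multiplying by phi turns the comparison into an identity between functions holomorphic
  on a disc about 0; its radius 2 is just a convenient number above |\<i>| = 1. The two convolutions
  converge for different reasons. For h * g the moments of h decay like q^(alpha e^2/2), against the
  geometric bound |G_e(x)| <= (1 + |x|)^e. For g * h the moments of g are merely shown to be
  bounded, and the decay comes from the q-derivatives of h, estimated on a disc so large that each
  q-derivative gains a factor 1/2. The main obstacle is that vanishing moments must force f to
  vanish on the lattice. A polynomial peaked at one lattice point is summed against f. Such a
  polynomial is unbounded far out, so the error there is charged to an absolute moment whose order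
  is the degree of the polynomial, and the degree has to tend to infinity.\<close>

section \<open>The infinite product (a;q)_oo as an entire function of a\<close>

lemma q_poch_inf_tendsto:
  fixes q :: real and a :: complex
  assumes "0 < q" "q < 1"
  shows "(\<lambda>n. \<Prod>j<n. 1 - a * of_real q ^ j) \<longlonglongrightarrow> q_poch_inf a q"
proof -
  have "summable (\<lambda>j. cmod a * q ^ j)"
    using assms by (intro summable_mult summable_geometric) auto
  then have "abs_convergent_prod (\<lambda>j. 1 - a * of_real q ^ j)"
    using assms by (simp add: abs_convergent_prod_conv_summable norm_mult norm_power)
  then have "convergent_prod (\<lambda>j. 1 - a * of_real q ^ j)"
    by (rule abs_convergent_prod_imp_convergent_prod)
  then have "(\<lambda>n. \<Prod>j\<le>n. 1 - a * of_real q ^ j) \<longlonglongrightarrow> q_poch_inf a q"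
    unfolding q_poch_inf_def by (intro has_prod_imp_tendsto convergent_prod_has_prod)
  then show ?thesis
    by (subst (asm) lessThan_Suc_atMost [symmetric]) (rule LIMSEQ_imp_Suc)
qed

lemma q_poch_inf_rec:
  assumes "0 < q" "q < 1"
  shows "q_poch_inf a q = (1 - a) * q_poch_inf (a * of_real q) q"
proof -
  have "(\<lambda>n. (1 - a) * (\<Prod>j<n. 1 - (a * of_real q) * of_real q ^ j)) \<longlonglongrightarrow>
      (1 - a) * q_poch_inf (a * of_real q) q"
    by (intro tendsto_intros q_poch_inf_tendsto assms)
  moreover have "(\<lambda>n. (1 - a) * (\<Prod>j<n. 1 - (a * of_real q) * of_real q ^ j)) =
      (\<lambda>n. \<Prod>j<Suc n. 1 - a * of_real q ^ j)"
    by (subst prod.lessThan_Suc_shift) (simp add: mult_ac)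
  ultimately show ?thesis
    using LIMSEQ_unique LIMSEQ_Suc [OF q_poch_inf_tendsto [OF assms]] by metis
qed

lemma holomorphic_q_poch_inf:
  assumes "0 < q" "q < 1"
  shows "(\<lambda>a. q_poch_inf a q) holomorphic_on UNIV"
proof (rule holomorphic_uniform_sequence)
  define P where "P = (\<lambda>n a. \<Prod>j<n. 1 - a * complex_of_real q ^ j)"
  show "P n holomorphic_on UNIV" for n
    unfolding P_def by (intro holomorphic_intros)
  show "\<exists>d>0. cball z d \<subseteq> UNIV \<and> uniform_limit (cball z d) P (\<lambda>a. q_poch_inf a q) sequentially"
    for z :: complex
  proof -
    \<comment> \<open>Products converge uniformly where the sums of |factor - 1| do; on the unit
      disc about z these are dominated by a geometric series.\<close>
    have "uniformly_convergent_on (cball z 1) (\<lambda>N a. \<Sum>n<N. norm ((1 - a * complex_of_real q ^ n) - 1))"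
    proof (rule Weierstrass_m_test')
      show "summable (\<lambda>n. (cmod z + 1) * q ^ n)"
        using assms by (intro summable_mult summable_geometric) auto
      show "norm (norm ((1 - a * complex_of_real q ^ n) - 1)) \<le> (cmod z + 1) * q ^ n"
        if "a \<in> cball z 1" for n a
      proof -
        have "cmod a \<le> cmod z + 1"
          using that norm_triangle_ineq2[of a z] by (simp add: dist_norm norm_minus_commute)
        then show ?thesis
          using assms by (simp add: norm_mult norm_power mult_right_mono)
      qed
    qed
    then have "uniformly_convergent_on (cball z 1) P"
      unfolding P_def by (intro uniformly_convergent_on_prod' continuous_intros) auto
    then obtain l where l: "uniform_limit (cball z 1) P l sequentially"
      by (auto simp: uniformly_convergent_on_def)
    have "l a = q_poch_inf a q" if "a \<in> cball z 1" for a
      using tendsto_uniform_limitI[OF l that] q_poch_inf_tendsto[OF assms, of a]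
      unfolding P_def by (rule LIMSEQ_unique)
    then have "uniform_limit (cball z 1) P (\<lambda>a. q_poch_inf a q) sequentially"
      using l by (metis (mono_tags, lifting) uniform_limit_cong')
    then show ?thesis
      by (intro exI[of _ 1]) auto
  qed
qed auto

text \<open>For a \<le> 0 every factor is at least 1, so truncating the product only decreases it.
  The free length m later gives decay of the q-Gaussian of any polynomial order.\<close>

lemma norm_q_poch_inf_ge_prod:
  fixes a q :: real
  assumes "0 < q" "q < 1" "a \<le> 0"
  shows "(\<Prod>j<m. 1 - a * q ^ j) \<le> cmod (q_poch_inf (of_real a) q)"
proof (rule tendsto_lowerbound)
  show "(\<lambda>n. cmod (\<Prod>j<n. 1 - of_real a * of_real q ^ j)) \<longlonglongrightarrow> cmod (q_poch_inf (of_real a) q)"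
    by (intro tendsto_intros q_poch_inf_tendsto assms)
  have ge1: "1 \<le> 1 - a * q ^ j" for j
    using assms by (simp add: mult_nonpos_nonneg)
  have "(\<Prod>j<m. 1 - a * q ^ j) \<le> cmod (\<Prod>j<n. 1 - of_real a * of_real q ^ j)" if "n \<ge> m" for n
  proof -
    have "cmod (1 - of_real a * of_real q ^ j) = 1 - a * q ^ j" for j
    proof -
      have "complex_of_real (1 - a * q ^ j) = 1 - of_real a * of_real q ^ j"
        by simp
      then show ?thesis
        using ge1[of j] by (metis norm_of_real abs_of_nonneg order_trans zero_le_one)
    qed
    then have "cmod (\<Prod>j<n. 1 - of_real a * of_real q ^ j) = (\<Prod>j<n. 1 - a * q ^ j)"
      by (simp add: prod_norm [symmetric])
    moreover have "(\<Prod>j<m. 1 - a * q ^ j) \<le> (\<Prod>j<n. 1 - a * q ^ j)"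
      using that ge1 order_trans[OF zero_le_one ge1] by (intro prod_mono2) auto
    ultimately show ?thesis by simp
  qed
  then show "\<forall>\<^sub>F n in sequentially. (\<Prod>j<m. 1 - a * q ^ j) \<le> cmod (\<Prod>j<n. 1 - of_real a * of_real q ^ j)"
    by (auto simp: eventually_sequentially)
qed auto

lemma norm_q_poch_inf_ge_1:
  fixes a q :: real
  assumes "0 < q" "q < 1" "a \<le> 0"
  shows "1 \<le> cmod (q_poch_inf (of_real a) q)"
  using norm_q_poch_inf_ge_prod[OF assms, of 0] by simp

lemma q_poch_inf_1:
  assumes "0 < q" "q < 1"
  shows "q_poch_inf 1 q = 0"
  using q_poch_inf_rec[OF assms, of 1] by simp

section \<open>Functional equation and decay of the q-Gaussian on the real line\<close>

text \<open>This is \<open>q_poch_inf_rec\<close> in base q^2, inverted. The restriction to real x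
  keeps 1 + x^2 away from 0; at x = \<i> the identity fails, its right side being 0 and its left
  side not.\<close>

lemma gauss_dilate:
  fixes q x :: real
  assumes "0 < q" "q < 1"
  shows "q_exp (q\<^sup>2) (- (of_real (q * x))\<^sup>2) = (1 + (of_real x)\<^sup>2) * q_exp (q\<^sup>2) (- (of_real x)\<^sup>2)"
proof -
  have q2: "0 < q\<^sup>2" "q\<^sup>2 < 1"
    using assms by (auto simp: power_less_one_iff)
  have eq: "q_poch_inf (- (of_real x)\<^sup>2) (q\<^sup>2) =
      (1 + (of_real x)\<^sup>2) * q_poch_inf (- (of_real (q * x))\<^sup>2) (q\<^sup>2)"
    using q_poch_inf_rec[OF q2, of "- (of_real x)\<^sup>2"] by (simp add: power_mult_distrib mult_ac)
  have "1 + (complex_of_real x)\<^sup>2 = complex_of_real (1 + x\<^sup>2)" by simp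
  moreover have "1 + x\<^sup>2 \<noteq> 0"
    using zero_le_power2[of x] by linarith
  ultimately have "1 + (complex_of_real x)\<^sup>2 \<noteq> 0"
    using of_real_eq_0_iff by metis
  then show ?thesis
    using eq by (simp add: q_exp_def)
qed

text \<open>Keep m factors 1 + x^2 q^(2j) of the denominator and drop the 1 in each. The resulting
  q^(m(m-1)) is weakened to q^(m m) so that the bound becomes a pure m-th power. The second bound
  serves near 0, where the first is useless.\<close>

lemma norm_gauss_le:
  fixes q x :: real
  assumes "0 < q" "q < 1" "x \<noteq> 0"
  shows "cmod (q_exp (q\<^sup>2) (- (of_real x)\<^sup>2)) \<le> inverse ((q ^ m * x\<^sup>2) ^ m)"
    and "cmod (q_exp (q\<^sup>2) (- (of_real x)\<^sup>2)) \<le> 1"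
proof -
  have q2: "0 < q\<^sup>2" "q\<^sup>2 < 1"
    using assms by (auto simp: power_less_one_iff)
  have x2: "- (complex_of_real x)\<^sup>2 = of_real (- x\<^sup>2)" by simp
  have "(q ^ m * x\<^sup>2) ^ m \<le> (\<Prod>j<m. 1 - (- x\<^sup>2) * (q\<^sup>2) ^ j)"
  proof -
    have *: "(\<Prod>j<m. (q\<^sup>2) ^ j) \<ge> q ^ (m * m)"
    proof -
      have "(\<Prod>j<m. (q\<^sup>2) ^ j) = q ^ (m * (m - 1))"
      proof (induction m)
        case (Suc m)
        have "(\<Prod>j<Suc m. (q\<^sup>2) ^ j) = q ^ (m * (m - 1) + 2 * m)"
          using Suc by (simp add: power_add power_mult)
        also have "m * (m - 1) + 2 * m = Suc m * (Suc m - 1)"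
          by (cases m) auto
        finally show ?case .
      qed auto
      also have "\<dots> \<ge> q ^ (m * m)"
        using assms by (intro power_decreasing) auto
      finally show ?thesis .
    qed
    have "(q ^ m * x\<^sup>2) ^ m = q ^ (m * m) * (x\<^sup>2) ^ m"
      by (simp add: power_mult_distrib power_mult)
    also have "\<dots> \<le> (\<Prod>j<m. (q\<^sup>2) ^ j) * (x\<^sup>2) ^ m"
      by (intro mult_right_mono *) auto
    also have "\<dots> = (\<Prod>j<m. x\<^sup>2 * (q\<^sup>2) ^ j)"
      by (simp add: prod.distrib)
    also have "\<dots> \<le> (\<Prod>j<m. 1 - (- x\<^sup>2) * (q\<^sup>2) ^ j)"
      by (intro prod_mono) auto
    finally show ?thesis .
  qed
  also have "\<dots> \<le> cmod (q_poch_inf (- (of_real x)\<^sup>2) (q\<^sup>2))"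
    unfolding x2 by (intro norm_q_poch_inf_ge_prod q2) auto
  finally have "(q ^ m * x\<^sup>2) ^ m \<le> cmod (q_poch_inf (- (of_real x)\<^sup>2) (q\<^sup>2))" .
  moreover have "0 < (q ^ m * x\<^sup>2) ^ m"
    using assms by simp
  ultimately show "cmod (q_exp (q\<^sup>2) (- (of_real x)\<^sup>2)) \<le> inverse ((q ^ m * x\<^sup>2) ^ m)"
    unfolding q_exp_def inverse_eq_divide [symmetric] norm_inverse
    by (intro le_imp_inverse_le)
  have "1 \<le> cmod (q_poch_inf (- (of_real x)\<^sup>2) (q\<^sup>2))"
    unfolding x2 by (intro norm_q_poch_inf_ge_1 q2) auto
  then show "cmod (q_exp (q\<^sup>2) (- (of_real x)\<^sup>2)) \<le> 1"
    unfolding q_exp_def norm_divide norm_one by (simp add: divide_le_eq_1)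
qed

section \<open>q-derivatives of entire functions\<close>

text \<open>The numerator u vanishes at 0, so u(z)/z has a removable singularity there, and the
  limit in \<open>q_deriv\<close> picks exactly the value \<open>deriv u 0\<close> that removes
  it.\<close>

lemma holomorphic_q_deriv:
  assumes "0 < q" "q < 1" and f: "f holomorphic_on UNIV"
  shows "q_deriv q f holomorphic_on UNIV"
proof -
  define u where "u = (\<lambda>z. (f z - f (of_real q * z)) / (1 - of_real q))"
  have fq: "(\<lambda>z. f (of_real q * z)) holomorphic_on UNIV"
    using holomorphic_on_compose_gen[OF _ f, of "\<lambda>z. of_real q * z" UNIV]
    by (auto simp: o_def intro!: holomorphic_intros)
  have "u holomorphic_on UNIV"
    unfolding u_def using assms by (intro holomorphic_intros fq) auto
  from pole_lemma_open[OF this open_UNIV, of 0]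
  have h: "(\<lambda>z. if z = 0 then deriv u 0 else (u z - u 0) / (z - 0)) holomorphic_on UNIV"
    (is "?h holomorphic_on _") .
  define H where "H = ?h"
  have nz: "q_deriv q f z = H z" if "z \<noteq> 0" for z
    using that by (simp add: q_deriv_def u_def H_def)
  have "((\<lambda>y. (f y - f (of_real q * y)) / ((1 - of_real q) * y)) \<longlongrightarrow> H 0) (at 0)"
  proof (rule Lim_transform_eventually)
    have "continuous_on UNIV H"
      unfolding H_def by (rule holomorphic_on_imp_continuous_on) (rule h)
    then have "isCont H 0"
      by (simp add: continuous_on_eq_continuous_at)
    then show "(H \<longlongrightarrow> H 0) (at 0)"
      by (simp add: isCont_def)
    show "\<forall>\<^sub>F z in at 0. H z = (f z - f (of_real q * z)) / ((1 - of_real q) * z)"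
      by (simp add: eventually_at_filter u_def H_def)
  qed
  then have "q_deriv q f 0 = H 0"
    by (simp add: q_deriv_def tendsto_Lim)
  with nz have "q_deriv q f z = H z" for z
    by (cases "z = 0") simp_all
  then have "q_deriv q f = H" ..
  with h show ?thesis
    by (simp only: H_def)
qed

text \<open>The quotient is hard to bound near 0, where one divides by a small z. By the maximum
  modulus principle it is enough to bound it on the circle of radius r, where the division costs
  exactly 1/r.\<close>

lemma norm_q_deriv_le:
  assumes "0 < q" "q < 1" "0 < r" and f: "f holomorphic_on UNIV"
    and B: "\<And>z. z \<in> cball 0 r \<Longrightarrow> cmod (f z) \<le> B" and z: "z \<in> cball 0 r"
  shows "cmod (q_deriv q f z) \<le> 2 / ((1 - q) * r) * B"
proof (rule maximum_modulus_frontier[of "q_deriv q f" "cball 0 r"])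
  have h: "q_deriv q f holomorphic_on UNIV"
    by (rule holomorphic_q_deriv) fact+
  then show "q_deriv q f holomorphic_on interior (cball 0 r)"
    by (rule holomorphic_on_subset) auto
  show "continuous_on (closure (cball 0 r)) (q_deriv q f)"
    using h by (intro holomorphic_on_imp_continuous_on) (rule holomorphic_on_subset, auto)
  show "cmod (q_deriv q f w) \<le> 2 / ((1 - q) * r) * B" if "w \<in> frontier (cball 0 r)" for w
  proof -
    have w: "cmod w = r" using that assms by simp
    have "cmod (of_real q * w) \<le> r"
      using assms w by (simp add: norm_mult mult_left_le_one_le)
    then have "cmod (f w - f (of_real q * w)) \<le> B + B"
      using w by (intro order_trans[OF norm_triangle_ineq4] add_mono B) auto
    moreover have "cmod (1 - of_real q) = 1 - q"
      using assms by (metis abs_of_pos diff_gt_0_iff_gt norm_of_real of_real_1 of_real_diff)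
    ultimately show ?thesis
      using assms w by (auto simp: q_deriv_def norm_divide norm_mult divide_right_mono)
  qed
qed (use z in auto)

lemma holomorphic_q_deriv_funpow:
  assumes "0 < q" "q < 1" and f: "f holomorphic_on UNIV"
  shows "(q_deriv q ^^ e) f holomorphic_on UNIV"
  by (induction e) (auto intro: holomorphic_q_deriv assms)

lemma norm_q_deriv_funpow_le:
  assumes "0 < q" "q < 1" "0 < r" and f: "f holomorphic_on UNIV"
    and B: "\<And>z. z \<in> cball 0 r \<Longrightarrow> cmod (f z) \<le> B" and z: "z \<in> cball 0 r"
  shows "cmod ((q_deriv q ^^ e) f z) \<le> (2 / ((1 - q) * r)) ^ e * B"
  using z
proof (induction e arbitrary: z)
  case (Suc e)
  show ?case
    using norm_q_deriv_le[OF assms(1-3) holomorphic_q_deriv_funpow[OF assms(1,2) f, of e] Suc.IH Suc.prems]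
    by (simp add: mult_ac)
qed (use B in auto)

section \<open>Iterated q-derivatives away from 0, and those of the q-Gaussian\<close>

lemma q_num_Suc: "q < 1 \<Longrightarrow> q_num q (Suc e) = q_num q e + q ^ e"
  by (simp add: q_num_def field_simps)

lemma q_fact_ge_1:
  assumes "0 < q" "q < 1"
  shows "1 \<le> q_fact q e"
  unfolding q_fact_def
proof (rule prod_ge_1)
  fix i assume "i \<in> {1..e}"
  then have "q ^ i \<le> q ^ 1"
    using assms by (intro power_decreasing) auto
  then show "1 \<le> q_num q i"
    using assms by (simp add: q_num_def)
qed

text \<open>Iterated q-Leibniz rule for the factor y. One step is the product rule in the form q x
  (\<partial>h)(x) + h(x); in the induction the coefficients of the lower term add up by
  \<open>q_num_Suc\<close>.\<close>

lemma q_deriv_funpow_mult_id: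
  assumes "0 < q" "q < 1" "x \<noteq> 0"
  shows "(q_deriv q ^^ Suc e) (\<lambda>y. y * h y) x =
    of_real (q ^ Suc e) * x * (q_deriv q ^^ Suc e) h x + of_real (q_num q (Suc e)) * (q_deriv q ^^ e) h x"
  using assms(3)
proof (induction e arbitrary: x)
  case 0
  have q1: "1 - complex_of_real q \<noteq> 0" using assms by auto
  have "x * h x - of_real q * x * h (of_real q * x) =
      of_real q * x * (h x - h (of_real q * x)) + h x * ((1 - of_real q) * x)"
    by (simp add: algebra_simps)
  then have "(x * h x - of_real q * x * h (of_real q * x)) / ((1 - of_real q) * x) =
      of_real q * x * ((h x - h (of_real q * x)) / ((1 - of_real q) * x)) + h x"
    using 0 q1 by (simp add: add_divide_distrib)
  then show ?case
    using 0 q1 assms by (simp add: q_deriv_def q_num_def)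
next
  case (Suc e)
  have q1: "1 - complex_of_real q \<noteq> 0" using assms by auto
  define D where "D = (q_deriv q ^^ e) h"
  define D1 where "D1 = q_deriv q D"
  have qx: "of_real q * x \<noteq> 0" using Suc.prems assms by auto
  have "(q_deriv q ^^ Suc (Suc e)) (\<lambda>y. y * h y) x =
    ((q_deriv q ^^ Suc e) (\<lambda>y. y * h y) x - (q_deriv q ^^ Suc e) (\<lambda>y. y * h y) (of_real q * x))
      / ((1 - of_real q) * x)"
    using Suc.prems by (simp add: q_deriv_def)
  also have "\<dots> = (of_real (q ^ Suc e) * x * D1 x + of_real (q_num q (Suc e)) * D x
     - (of_real (q ^ Suc e) * (of_real q * x) * D1 (of_real q * x) + of_real (q_num q (Suc e)) * D (of_real q * x)))
      / ((1 - of_real q) * x)"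
    using Suc.IH[OF Suc.prems] Suc.IH[OF qx] by (simp add: D1_def D_def)
  also have "\<dots> = of_real (q ^ Suc (Suc e)) * x * ((D1 x - D1 (of_real q * x)) / ((1 - of_real q) * x))
     + of_real (q ^ Suc e) * D1 x
     + of_real (q_num q (Suc e)) * ((D x - D (of_real q * x)) / ((1 - of_real q) * x))"
  proof -
    have "a * x * d + N * c - (a * (of_real q * x) * d' + N * c') =
        a * of_real q * x * (d - d') + a * d * ((1 - of_real q) * x) + N * (c - c')"
      for a d d' c c' N :: complex
      by (simp add: algebra_simps)
    then have "(a * x * d + N * c - (a * (of_real q * x) * d' + N * c')) / ((1 - of_real q) * x) =
        a * of_real q * x * ((d - d') / ((1 - of_real q) * x)) + a * d
          + N * ((c - c') / ((1 - of_real q) * x))"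
      for a d d' c c' N :: complex
      using Suc.prems q1 by (simp add: add_divide_distrib)
    from this [of "of_real (q ^ Suc e)"] show ?thesis
      by (simp only: power_Suc2 of_real_mult)
  qed
  also have "(D x - D (of_real q * x)) / ((1 - of_real q) * x) = D1 x"
    using Suc.prems by (simp add: D1_def q_deriv_def)
  also have "(D1 x - D1 (of_real q * x)) / ((1 - of_real q) * x) = (q_deriv q ^^ Suc (Suc e)) h x"
    using Suc.prems by (simp add: D1_def D_def q_deriv_def)
  finally show ?case
    using assms by (simp add: q_num_Suc[of q "Suc e"] D1_def D_def algebra_simps)
qed

text \<open>Away from 0 the e-th q-derivative at x only sees the values at x, q x, ..., q^e x. At 0
  it is a limit that depends on a whole neighbourhood, hence the exclusion of 0 from S.\<close>

lemma q_deriv_funpow_cong: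
  assumes "0 < q" and "\<And>x. x \<in> S \<Longrightarrow> of_real q * x \<in> S" and "0 \<notin> S"
    and "\<And>x. x \<in> S \<Longrightarrow> f x = g x" and "x \<in> S"
  shows "(q_deriv q ^^ e) f x = (q_deriv q ^^ e) g x"
  using assms(5)
proof (induction e arbitrary: x)
  case (Suc e)
  have "x \<noteq> 0" using Suc.prems assms(3) by auto
  then show ?case
    using Suc assms(2) by (simp add: q_deriv_def)
qed (use assms in auto)

text \<open>The polynomials \<open>G\<^sub>e\<close> with \<open>(1 - q)\<^sup>e \<partial>\<^sup>e g = G\<^sub>e g\<close> for the \<open>q\<close>-Gaussian \<open>g\<close>:
  up to scaling, discrete \<open>q\<close>-Hermite polynomials.\<close>

fun gauss_poly :: "real \<Rightarrow> nat \<Rightarrow> complex \<Rightarrow> complex" where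
  "gauss_poly q 0 x = 1"
| "gauss_poly q (Suc 0) x = - x"
| "gauss_poly q (Suc (Suc e)) x =
     - (of_real (q ^ Suc e) * x * gauss_poly q (Suc e) x + of_real (1 - q ^ Suc e) * gauss_poly q e x)"

lemma holomorphic_gauss_poly: "gauss_poly q e holomorphic_on UNIV"
  by (induction e rule: induct_nat_012) (auto intro!: holomorphic_intros)

text \<open>The coefficients t = q^(e+1) and 1 - t of the recursion lie in [0,1], so each step costs
  at most t |x| + (1 - t) \<le> 1 + |x|.\<close>

lemma norm_gauss_poly_le:
  assumes "0 < q" "q < 1"
  shows "cmod (gauss_poly q e x) \<le> (1 + cmod x) ^ e"
proof (induction e rule: induct_nat_012)
  case (ge2 e)
  define t where "t = q ^ Suc e"
  have t: "0 \<le> t" "t \<le> 1"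
    using assms by (auto simp: t_def power_le_one simp del: power_Suc)
  have "cmod (gauss_poly q (Suc (Suc e)) x) \<le>
      cmod (of_real t * x * gauss_poly q (Suc e) x) + cmod (of_real (1 - t) * gauss_poly q e x)"
    unfolding gauss_poly.simps t_def [symmetric] norm_minus_cancel by (rule norm_triangle_ineq)
  also have "\<dots> = t * cmod x * cmod (gauss_poly q (Suc e) x) + (1 - t) * cmod (gauss_poly q e x)"
    using t unfolding norm_mult norm_of_real by simp
  also have "\<dots> \<le> t * cmod x * (1 + cmod x) ^ Suc e + (1 - t) * (1 + cmod x) ^ Suc e"
  proof (intro add_mono mult_left_mono ge2)
    have "(1 + cmod x) ^ e \<le> (1 + cmod x) ^ Suc e"
      by (intro power_increasing) auto
    with ge2(1) show "cmod (gauss_poly q e x) \<le> (1 + cmod x) ^ Suc e"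
      by linarith
  qed (use t in auto)
  also have "\<dots> = (t * cmod x + (1 - t)) * (1 + cmod x) ^ Suc e"
    by (simp only: distrib_right)
  also have "\<dots> \<le> (1 + cmod x) * (1 + cmod x) ^ Suc e"
    using t mult_left_le_one_le[of "cmod x" t] by (intro mult_right_mono) auto
  finally show ?case by simp
qed auto

text \<open>At \<i> the weights t and 1 - t multiply equal quantities, because \<i> (-\<i>) = 1, so
  t cancels from the recursion. In particular no value at \<i> vanishes.\<close>

lemma gauss_poly_ii: "gauss_poly q e \<i> = (- \<i>) ^ e"
proof (induction e rule: induct_nat_012)
  case (ge2 e)
  define t where "t = complex_of_real (q ^ Suc e)"
  have "gauss_poly q (Suc (Suc e)) \<i> = - (t * \<i> * (- \<i> * (- \<i>) ^ e) + (1 - t) * (- \<i>) ^ e)"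
    unfolding gauss_poly.simps ge2 t_def by simp
  also have "\<dots> = - \<i> * (- \<i> * (- \<i>) ^ e)"
    by (simp add: algebra_simps)
  finally show ?case by simp
qed (simp_all)

text \<open>The functional equation gives \<partial>g = - x g / (1 - q). Applying e + 1 further
  q-derivatives to x g by the q-Leibniz rule yields the three-term recursion that defines
  \<open>gauss_poly\<close>.\<close>

lemma q_deriv_funpow_gauss:
  assumes "0 < q" "q < 1" "x \<noteq> (0::real)"
  defines "g \<equiv> \<lambda>z. q_exp (q\<^sup>2) (- z\<^sup>2)"
  shows "(q_deriv q ^^ e) g (of_real x) =
    gauss_poly q e (of_real x) * g (of_real x) / (1 - of_real q) ^ e"
  using assms(3)
proof (induction e rule: induct_nat_012)
  define k where "k = (1 - complex_of_real q)"
  have k: "k \<noteq> 0" using assms by (auto simp: k_def)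
  have D: "q_deriv q g (of_real r) = - of_real r * g (of_real r) / k" if "r \<noteq> 0" for r :: real
  proof -
    have "g (of_real q * of_real r) = (1 + (of_real r)\<^sup>2) * g (of_real r)"
      using gauss_dilate[OF assms(1,2), of r] by (simp add: g_def)
    moreover have "(G - (1 + R\<^sup>2) * G) / (k * R) = - R * G / k" if "R \<noteq> 0" for G R :: complex
      using k that by (simp add: field_simps power2_eq_square)
    ultimately show ?thesis
      using that by (simp add: q_deriv_def k_def)
  qed
  {
    case 0
    then show ?case by simp
  next
    case 1
    then show ?case
      using D[of x] by (simp add: k_def)
  next
    case (ge2 e)
    \<comment> \<open>The formula for the first q-derivative is known only at nonzero real points.
      This set is stable under multiplication by q, so the formula may be substituted under further
      q-derivatives.\<close>
    define S where "S = complex_of_real ` (UNIV - {0})"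
    have D1: "q_deriv q g y = (-1 / k) * (y * g y)" if "y \<in> S" for y
      using that D by (auto simp: S_def)
    have S: "of_real q * y \<in> S" if "y \<in> S" for y
      using that assms by (auto simp: S_def simp flip: of_real_mult)
    have scale: "(q_deriv q ^^ n) (\<lambda>y. c * h y) y = c * (q_deriv q ^^ n) h y" if "y \<in> S" for n c h y
      using that
    proof (induction n arbitrary: y)
      case (Suc n)
      then have "y \<noteq> 0" by (auto simp: S_def)
      then show ?case
        using Suc S by (simp add: q_deriv_def right_diff_distrib)
    qed auto
    have xS: "of_real x \<in> S" using ge2 by (auto simp: S_def)
    have "(q_deriv q ^^ Suc (Suc e)) g (of_real x) = (q_deriv q ^^ Suc e) (q_deriv q g) (of_real x)"
      by (simp only: funpow_Suc_right o_apply)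
    also have "\<dots> = (q_deriv q ^^ Suc e) (\<lambda>y. (-1 / k) * (y * g y)) (of_real x)"
      by (rule q_deriv_funpow_cong[of q S]) (use assms S D1 xS in \<open>auto simp: S_def\<close>)
    also have "\<dots> = (-1 / k) * (q_deriv q ^^ Suc e) (\<lambda>y. y * g y) (of_real x)"
      by (rule scale[OF xS])
    also have "\<dots> = (-1 / k) * (of_real (q ^ Suc e) * of_real x * (q_deriv q ^^ Suc e) g (of_real x) +
        of_real (q_num q (Suc e)) * (q_deriv q ^^ e) g (of_real x))"
      using ge2 assms by (subst q_deriv_funpow_mult_id) auto
    also have "of_real (q_num q (Suc e)) = of_real (1 - q ^ Suc e) / k"
      by (simp add: q_num_def k_def)
    also have "(q_deriv q ^^ Suc e) g (of_real x) = gauss_poly q (Suc e) (of_real x) * g (of_real x) / k ^ Suc e"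
      unfolding k_def by (rule ge2.IH) (rule ge2.prems)
    also have "(q_deriv q ^^ e) g (of_real x) = gauss_poly q e (of_real x) * g (of_real x) / k ^ e"
      unfolding k_def by (rule ge2.IH) (rule ge2.prems)
    also have "(-1 / k) * (a * of_real x * (G1 * G / k ^ Suc e) + b / k * (G0 * G / k ^ e)) =
        - (a * of_real x * G1 + b * G0) * G / k ^ Suc (Suc e)" for a b G1 G0 G
      using k by (simp add: add_divide_distrib diff_divide_distrib distrib_left distrib_right
        left_diff_distrib right_diff_distrib mult_ac)
    finally show ?case
      by (simp only: gauss_poly.simps k_def)
  }
qed

section \<open>Summation over the lattice, dilations and moments\<close>

lemma summable_on_geometric_lattice:
  fixes h :: "int \<times> real \<Rightarrow> real"
  assumes "0 \<le> r" "r < 1"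
    and bound: "\<And>k \<epsilon>. \<epsilon> \<in> {1, -1} \<Longrightarrow> \<bar>h (k, \<epsilon>)\<bar> \<le> C * r ^ nat \<bar>k\<bar>"
  shows "h summable_on (UNIV \<times> {1, -1})"
proof -
  have geo: "(\<lambda>n. C * r ^ n) summable_on (UNIV :: nat set)"
    using assms by (intro norm_summable_imp_summable_on)
      (auto simp: abs_mult power_abs intro!: summable_mult summable_geometric)
  have half: "h summable_on (\<lambda>n::nat. (s * int n, \<epsilon>)) ` UNIV" if "s \<in> {1, -1}" "\<epsilon> \<in> {1, -1}" for s \<epsilon>
  proof -
    have inj: "inj (\<lambda>n::nat. (s * int n, \<epsilon>))"
      using that by (auto simp: inj_on_def)
    have "norm ((h \<circ> (\<lambda>n. (s * int n, \<epsilon>))) n) \<le> C * r ^ n" for n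
      using bound[of \<epsilon> "s * int n"] that by (auto simp: abs_mult)
    then have "(h \<circ> (\<lambda>n. (s * int n, \<epsilon>))) summable_on UNIV"
      using Infinite_Sum.abs_summable_on_comparison_test'[OF geo] abs_summable_summable by blast
    then show ?thesis
      using summable_on_reindex[OF inj, of h] by simp
  qed
  \<comment> \<open>Four copies of the naturals cover the index set; they overlap at k = 0, which is
    harmless for summability.\<close>
  have "(UNIV :: int set) \<times> {1, -1} =
    ((\<lambda>n::nat. (1 * int n, 1)) ` UNIV \<union> (\<lambda>n::nat. (-1 * int n, 1)) ` UNIV) \<union>
    ((\<lambda>n::nat. (1 * int n, -1)) ` UNIV \<union> (\<lambda>n::nat. (-1 * int n, -1::real)) ` UNIV)"
  proof -
    have "\<exists>n. k = int n \<or> k = - int n" for k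
      by (metis int_cases2)
    then show ?thesis
      by (auto simp: image_iff) metis+
  qed
  then show ?thesis
    by (simp only:) (intro summable_on_union half; simp)
qed

lemma q_integral_cong:
  assumes "0 < q" "0 < \<gamma>"
    and "\<And>x. x \<noteq> 0 \<Longrightarrow> f (complex_of_real x) = g (complex_of_real x)"
  shows "q_integral q \<gamma> f = q_integral q \<gamma> g"
proof -
  have "q_integral_term q \<gamma> f p = q_integral_term q \<gamma> g p" if "p \<in> UNIV \<times> {1, -1}" for p
  proof -
    obtain k \<epsilon> where p: "p = (k, \<epsilon>)" "\<epsilon> \<noteq> 0" using \<open>p \<in> _\<close> by auto
    then have "\<epsilon> * q powi k * \<gamma> \<noteq> 0" using assms by auto
    from assms(3)[OF this] show ?thesis by (simp add: q_integral_term_def p)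
  qed
  then show ?thesis
    unfolding q_integral_def by (simp cong: infsum_cong)
qed

text \<open>Dilation is the shift k to k + m of the index; the weight q^k turns it into the factor
  q^(-m).\<close>

lemma q_integral_dilate:
  fixes f :: "complex \<Rightarrow> 'a::real_normed_vector"
  assumes "0 < q"
  shows "q_integral q \<gamma> (\<lambda>x. f (of_real (q powi m) * x)) = q powi (- m) *\<^sub>R q_integral q \<gamma> f"
proof -
  have "infsum (q_integral_term q \<gamma> (\<lambda>x. f (of_real (q powi m) * x))) (UNIV \<times> {1, -1}) =
      infsum (\<lambda>p. q powi (- m) *\<^sub>R q_integral_term q \<gamma> f p) (UNIV \<times> {1, -1})"
    by (rule infsum_reindex_bij_witness[where i = "\<lambda>(k, \<epsilon>). (k - m, \<epsilon>)" and j = "\<lambda>(k, \<epsilon>). (k + m, \<epsilon>)"])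
      (use assms in \<open>auto simp: q_integral_term_def power_int_add power_int_minus mult_ac\<close>)
  then show ?thesis
    by (simp add: q_integral_def infsum_scaleR_right mult.commute)
qed

text \<open>With m = -n the factor is (q^n)^(e+1), so the dilation enters the convolution only
  through powers of q^n. The extra power comes from the weight of the integral.\<close>

lemma q_moment_dilate:
  assumes "0 < q"
  shows "q_moment q \<gamma> (q_dil q m f) e = of_real ((q powi (- m)) ^ Suc e) * q_moment q \<gamma> f e"
proof -
  have "(\<lambda>x. q_dil q m f x * x ^ e) =
      (\<lambda>x. of_real ((q powi (- m)) ^ e) * (\<lambda>y. f y * y ^ e) (of_real (q powi m) * x))"
  proof
    fix x
    have "(q powi (- m)) ^ e * (q powi m) ^ e = (q powi (- m) * q powi m) ^ e"
      by (simp only: power_mult_distrib)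
    then have "(q powi (- m)) ^ e * (q powi m) ^ e = 1"
      using assms by (simp add: power_int_minus)
    then have "complex_of_real ((q powi (- m)) ^ e) * of_real (q powi m) ^ e = 1"
      by (metis of_real_1 of_real_mult of_real_power)
    then show "q_dil q m f x * x ^ e =
        of_real ((q powi (- m)) ^ e) * (\<lambda>y. f y * y ^ e) (of_real (q powi m) * x)"
      unfolding q_dil_def power_mult_distrib by (metis (no_types, lifting) mult.assoc mult.commute mult.left_neutral)
  qed
  then have "q_integral q \<gamma> (\<lambda>x. q_dil q m f x * x ^ e) =
      q_integral q \<gamma> (\<lambda>x. of_real ((q powi (- m)) ^ e) * (\<lambda>y. f y * y ^ e) (of_real (q powi m) * x))"
    by simp
  also have "\<dots> = of_real ((q powi (- m)) ^ e) * q_integral q \<gamma> (\<lambda>x. (\<lambda>y. f y * y ^ e) (of_real (q powi m) * x))"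
  proof -
    have "q_integral_term q \<gamma> (\<lambda>x. c * h x) = (\<lambda>p. c * q_integral_term q \<gamma> h p)"
      for c and h :: "complex \<Rightarrow> complex"
      by (auto simp: q_integral_term_def fun_eq_iff)
    then show ?thesis
      unfolding q_integral_def by (simp only: infsum_cmult_right') simp
  qed
  also have "\<dots> = of_real ((q powi (- m)) ^ e) * (q powi (- m) *\<^sub>R q_integral q \<gamma> (\<lambda>y. f y * y ^ e))"
    by (subst q_integral_dilate[OF assms, of \<gamma> "\<lambda>y. f y * y ^ e" m]) simp
  finally show ?thesis
    by (simp add: q_moment_def scaleR_conv_of_real mult_ac)
qed

lemma norm_q_moment_le:
  assumes "0 < q" "q < 1" "0 < \<gamma>" "q_integrable q \<gamma> (\<lambda>x. f x * x ^ e)"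
  shows "cmod (q_moment q \<gamma> f e) \<le> q_abs_moment q \<gamma> f e"
proof -
  have norm_term: "norm (q_integral_term q \<gamma> h p) = q_integral_term q \<gamma> (\<lambda>x. cmod (h x)) p" for h p
    using assms by (auto simp: q_integral_term_def split: prod.splits)
  have "cmod (infsum (q_integral_term q \<gamma> (\<lambda>x. f x * x ^ e)) (UNIV \<times> {1, -1})) \<le>
      infsum (\<lambda>p. norm (q_integral_term q \<gamma> (\<lambda>x. f x * x ^ e) p)) (UNIV \<times> {1, -1})"
    using assms(4) unfolding q_integrable_def by (rule norm_infsum_bound)
  also have "\<dots> = infsum (q_integral_term q \<gamma> (\<lambda>x. cmod (f x * x ^ e))) (UNIV \<times> {1, -1})"
    by (simp only: norm_term)
  finally have "cmod (q_integral q \<gamma> (\<lambda>x. f x * x ^ e)) \<le> q_integral q \<gamma> (\<lambda>x. cmod (f x * x ^ e))"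
    using assms unfolding q_integral_def by (auto intro: mult_left_mono)
  then show ?thesis
    using assms by (auto simp: q_moment_def q_abs_moment_def norm_mult norm_power intro: mult_left_mono)
qed

section \<open>Moments of the q-Gaussian\<close>

text \<open>The weight of the integral is |x|, so the summand is |x|^m times the Gaussian with m = e
  + 1. For k \<ge> 0 the Gaussian is bounded by 1 and |x|^m is geometrically small; for k < 0 the
  decay of order 2 m leaves |x|^(-m). The constant C adds the constants of both halves.\<close>

lemma q_integrable_gauss:
  assumes "0 < q" "q < 1" "0 < \<gamma>"
  shows "q_integrable q \<gamma> (\<lambda>x. q_exp (q\<^sup>2) (- x\<^sup>2) * x ^ e)"
  unfolding q_integrable_def
proof (rule summable_on_geometric_lattice)
  define m where "m = Suc e"
  define C where "C = \<gamma> ^ m + inverse (q ^ (m * m) * \<gamma> ^ m)"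
  show "\<bar>norm (q_integral_term q \<gamma> (\<lambda>x. q_exp (q\<^sup>2) (- x\<^sup>2) * x ^ e) (k, \<epsilon>))\<bar> \<le> C * q ^ nat \<bar>k\<bar>"
    if "\<epsilon> \<in> {1, -1}" for k \<epsilon>
  proof -
    define x where "x = \<epsilon> * q powi k * \<gamma>"
    define G where "G = cmod (q_exp (q\<^sup>2) (- (of_real x)\<^sup>2))"
    have ax: "\<bar>x\<bar> = q powi k * \<gamma>" "x \<noteq> 0"
      using assms that by (auto simp: x_def abs_mult)
    have "norm (q_integral_term q \<gamma> (\<lambda>x. q_exp (q\<^sup>2) (- x\<^sup>2) * x ^ e) (k, \<epsilon>)) = \<bar>x\<bar> ^ m * G"
      unfolding q_integral_term_def prod.case x_def[symmetric] ax(1)[symmetric]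
      by (simp add: G_def norm_mult norm_power m_def)
    also have "\<dots> \<le> C * q ^ nat \<bar>k\<bar>"
    proof (cases "k \<ge> 0")
      case True
      have "\<bar>x\<bar> ^ m * G \<le> \<bar>x\<bar> ^ m * 1"
        using norm_gauss_le(2)[OF assms(1,2) ax(2)] unfolding G_def by (intro mult_left_mono) auto
      also have "\<dots> = \<gamma> ^ m * (q ^ nat k) ^ m"
        using True by (simp add: ax power_mult_distrib power_int_def)
      also have "\<dots> \<le> \<gamma> ^ m * q ^ nat k"
        using assms by (intro mult_left_mono power_le_one_iff)
          (auto simp: m_def power_le_one mult_left_le)
      also have "\<dots> \<le> C * q ^ nat k"
        using assms by (intro mult_right_mono) (auto simp: C_def)
      finally show ?thesis using True by simp
    next
      case False
      define n where "n = nat (- k)"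
      have k: "k = - int n" using False by (simp add: n_def)
      have "\<bar>x\<bar> ^ m * G \<le> \<bar>x\<bar> ^ m * inverse ((q ^ m * x\<^sup>2) ^ m)"
        using norm_gauss_le(1)[OF assms(1,2) ax(2)] unfolding G_def by (intro mult_left_mono) auto
      also have "\<dots> = inverse (q ^ (m * m)) * inverse (\<bar>x\<bar> ^ m)"
      proof -
        have "y ^ m * inverse ((q ^ m * (y * y)) ^ m) = inverse (q ^ (m * m)) * inverse (y ^ m)"
          if "y \<noteq> 0" for y :: real
          using that assms by (simp add: power_mult_distrib power_mult field_simps)
        from this[of "\<bar>x\<bar>"] show ?thesis
          using ax(2) by (simp add: power2_eq_square)
      qed
      also have "inverse (\<bar>x\<bar> ^ m) = inverse (\<gamma> ^ m) * (q ^ n) ^ m"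
        using assms by (simp add: ax k power_int_minus power_mult_distrib field_simps)
      also have "inverse (q ^ (m * m)) * (inverse (\<gamma> ^ m) * (q ^ n) ^ m) \<le>
          inverse (q ^ (m * m)) * (inverse (\<gamma> ^ m) * q ^ n)"
        using assms by (intro mult_left_mono) (auto simp: m_def power_le_one mult_left_le)
      also have "\<dots> = inverse (q ^ (m * m) * \<gamma> ^ m) * q ^ n"
        by simp
      also have "\<dots> \<le> C * q ^ n"
        using assms by (intro mult_right_mono) (auto simp: C_def)
      finally show ?thesis using False by (simp add: n_def)
    qed
    finally show ?thesis by simp
  qed
qed (use assms in auto)

text \<open>Integrating the functional equation \<open>g (q x) = (1 + x\<^sup>2) g x\<close> against \<open>\<bar>x\<bar>\<close> to the \<open>e\<close> gives a
  two-step recursion for the absolute moments of \<open>g\<close>.\<close>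

lemma q_abs_moment_gauss_bounded:
  assumes "0 < q" "q < 1" "0 < \<gamma>"
  shows "\<exists>A. \<forall>e. q_abs_moment q \<gamma> (\<lambda>x. q_exp (q\<^sup>2) (- x\<^sup>2)) e \<le> A"
proof -
  define g where "g = (\<lambda>x. q_exp (q\<^sup>2) (- x\<^sup>2))"
  define S where "S = (\<lambda>e. q_integral q \<gamma> (\<lambda>x. cmod (g x * x ^ e)))"
  have norm_term: "norm (q_integral_term q \<gamma> h p) = q_integral_term q \<gamma> (\<lambda>x. cmod (h x)) p" for h p
    using assms by (auto simp: q_integral_term_def split: prod.splits)
  have summ: "q_integral_term q \<gamma> (\<lambda>x. cmod (g x * x ^ e)) summable_on (UNIV \<times> {1, -1})" for e
    using q_integrable_gauss[OF assms, of e] unfolding q_integrable_def norm_term g_def .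
  have S0: "0 \<le> S e" for e
    using assms unfolding S_def q_integral_def
    by (auto intro!: mult_nonneg_nonneg infsum_nonneg simp: q_integral_term_def split: prod.splits)
  have rec: "S (Suc (Suc e)) = (inverse (q ^ Suc e) - 1) * S e" for e
  proof -
    have "inverse q * S e = q_integral q \<gamma> (\<lambda>x. cmod (g (of_real q * x) * (of_real q * x) ^ e))"
      using q_integral_dilate[of q \<gamma> "\<lambda>x. cmod (g x * x ^ e)" 1] assms by (simp add: S_def power_int_minus)
    also have "\<dots> = q_integral q \<gamma> (\<lambda>x. q ^ e * (cmod (g x * x ^ e) + cmod (g x * x ^ Suc (Suc e))))"
    proof (rule q_integral_cong)
      fix x :: real
      have "g (of_real q * of_real x) = (1 + (of_real x)\<^sup>2) * g (of_real x)"
        using gauss_dilate[OF assms(1,2), of x] by (simp add: g_def)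
      moreover have "cmod (1 + (of_real x)\<^sup>2) = 1 + x\<^sup>2"
      proof -
        have "1 + (complex_of_real x)\<^sup>2 = complex_of_real (1 + x\<^sup>2)" by simp
        then show ?thesis
          by (metis abs_of_nonneg add_nonneg_nonneg norm_of_real zero_le_one zero_le_power2)
      qed
      ultimately have "cmod (g (of_real q * of_real x)) = (1 + x\<^sup>2) * cmod (g (of_real x))"
        by (simp only: norm_mult)
      then show "cmod (g (of_real q * of_real x) * (of_real q * of_real x) ^ e) =
          q ^ e * (cmod (g (of_real x) * (of_real x) ^ e) + cmod (g (of_real x) * (of_real x) ^ Suc (Suc e)))"
        using assms by (simp add: norm_mult norm_power power_mult_distrib algebra_simps power2_eq_square
            flip: abs_mult)
    qed (use assms in auto)
    also have "\<dots> = q ^ e * (S e + S (Suc (Suc e)))"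
    proof -
      have "q_integral_term q \<gamma> (\<lambda>x. q ^ e * (cmod (g x * x ^ e) + cmod (g x * x ^ Suc (Suc e)))) =
        (\<lambda>p. q ^ e * (q_integral_term q \<gamma> (\<lambda>x. cmod (g x * x ^ e)) p +
          q_integral_term q \<gamma> (\<lambda>x. cmod (g x * x ^ Suc (Suc e))) p))"
        by (auto simp: q_integral_term_def fun_eq_iff algebra_simps)
      then show ?thesis
        unfolding S_def q_integral_def
        by (simp only: infsum_cmult_right' infsum_add[OF summ summ]) (simp add: algebra_simps)
    qed
    finally show ?thesis
      using assms by (simp add: field_simps)
  qed
  \<comment> \<open>Over two steps the normalising exponent grows by 2 e + 3. Of this, e + 1
    compensates the growth in \<open>rec\<close> and the rest is a gain, so \<open>a\<close> does
    not increase along either parity class; hence the bound by its first two values.\<close>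
  define a where "a = (\<lambda>e. q ^ ((e\<^sup>2 + e) div 2) * S e)"
  have step: "a (Suc (Suc e)) \<le> a e" for e
  proof -
    have tri: "((Suc (Suc e))\<^sup>2 + Suc (Suc e)) div 2 = (e\<^sup>2 + e) div 2 + (Suc e + (e + 2))"
    proof -
      have "(Suc (Suc e))\<^sup>2 + Suc (Suc e) = (e\<^sup>2 + e) + (Suc e + (e + 2)) * 2"
        by (simp add: power2_eq_square)
      then show ?thesis by (simp only: div_mult_self1 zero_neq_numeral)
    qed
    have "a (Suc (Suc e)) = q ^ (e + 2) * (q ^ Suc e * (inverse (q ^ Suc e) - 1)) * a e"
      unfolding a_def rec tri by (simp add: power_add mult_ac)
    also have "q ^ Suc e * (inverse (q ^ Suc e) - 1) = 1 - q ^ Suc e"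
      using assms by (simp add: field_simps)
    also have "q ^ (e + 2) * (1 - q ^ Suc e) * a e \<le> 1 * a e"
    proof (rule mult_right_mono)
      have "q ^ (e + 2) \<le> 1" "q ^ Suc e \<le> 1" "0 \<le> q ^ Suc e"
        using assms by (auto intro!: power_le_one simp del: power_Suc)
      then show "q ^ (e + 2) * (1 - q ^ Suc e) \<le> 1"
        by (intro mult_le_one) auto
      show "0 \<le> a e" using assms S0 by (simp add: a_def)
    qed
    finally show ?thesis by simp
  qed
  have "a e \<le> max (a 0) (a 1)" for e
    by (induction e rule: induct_nat_012) (use step order_trans in fastforce)+
  then show ?thesis
    by (auto simp: a_def S_def g_def q_abs_moment_def)
qed

section \<open>Moment determinacy on the lattice\<close>

text \<open>A test polynomial concentrated at \<open>y = 1\<close> among the points \<open>y = \<plusminus>q\<^sup>m\<close>. The other points either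
  are zeros (\<open>y = -1\<close>, or \<open>-L \<le> m < 0\<close>), or satisfy \<open>\<bar>y\<bar> \<le> q\<close> so that \<open>y\<close> to the \<open>2 l\<close> is small, or lie
  so far out that the growth of the product with \<open>L\<close> is the only thing to control.\<close>

definition peak_poly :: "real \<Rightarrow> nat \<Rightarrow> nat \<Rightarrow> real poly" where
  "peak_poly q l L = [:1/2, 1/2:] * [:0, 1:] ^ (2 * l) * (\<Prod>j<L. [:1, 0, - ((q\<^sup>2) ^ Suc j):])"

lemma poly_peak_poly:
  "poly (peak_poly q l L) y = (1 + y) / 2 * y ^ (2 * l) * (\<Prod>j<L. 1 - (q\<^sup>2) ^ Suc j * y\<^sup>2)"
  by (simp add: peak_poly_def poly_prod power2_eq_square mult_ac) (simp add: algebra_simps)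

lemma poly_peak_poly_1: "poly (peak_poly q l L) 1 = (\<Prod>j<L. 1 - (q\<^sup>2) ^ Suc j)"
  by (simp add: poly_peak_poly)

text \<open>The first term covers the points with |y| \<le> q and vanishes as l grows. The second
  covers the far points: there each factor of the product is at most q^(2(j+1)) y^2, and the
  exponent 2 l + 2 L + 1 is the degree of the polynomial. In the remaining cases the polynomial is
  0.\<close>

lemma abs_poly_peak_poly_le:
  assumes "0 < q" "q < 1" "\<delta> \<in> {1, -1}" "\<not> (m = 0 \<and> \<delta> = 1)"
  shows "\<bar>poly (peak_poly q l L) (\<delta> * q powi m)\<bar> \<le> q ^ (2 * l) +
    q ^ (L * Suc L) * (q powi m) ^ (2 * l + 2 * L + 1)"
proof -
  define y where "y = \<delta> * q powi m"
  define w where "w = q powi m"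
  have w: "0 < w" using assms by (simp add: w_def)
  have y: "\<bar>y\<bar> = w" "y\<^sup>2 = w\<^sup>2"
    using assms by (auto simp: y_def w_def abs_mult power_mult_distrib)
  have rhs: "0 \<le> q ^ (L * Suc L) * w ^ (2 * l + 2 * L + 1)" "0 \<le> q ^ (2 * l)"
    using assms w by auto
  have q2: "0 < (q\<^sup>2) ^ Suc j" "(q\<^sup>2) ^ Suc j \<le> 1" for j
    using assms by (auto intro!: power_le_one simp del: power_Suc)
  have abs_p: "\<bar>poly (peak_poly q l L) y\<bar> =
      \<bar>(1 + y) / 2\<bar> * w ^ (2 * l) * (\<Prod>j<L. \<bar>1 - (q\<^sup>2) ^ Suc j * w\<^sup>2\<bar>)"
    unfolding poly_peak_poly abs_mult abs_prod power_abs y ..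
  consider "m = 0" | "m > 0" | "m < 0" "nat (- m) \<le> L" | "m < 0" "nat (- m) > L" by linarith
  then have "\<bar>poly (peak_poly q l L) y\<bar> \<le> q ^ (2 * l) + q ^ (L * Suc L) * w ^ (2 * l + 2 * L + 1)"
  proof cases
    case 1
    then have "y = -1" using assms by (auto simp: y_def)
    then have "\<bar>poly (peak_poly q l L) y\<bar> = 0" unfolding abs_p by simp
    then show ?thesis using rhs by linarith
  next
    case 2
    then have "w = q ^ nat m" by (simp add: w_def power_int_def)
    also have "\<dots> \<le> q ^ 1"
      using 2 assms by (intro power_decreasing) auto
    finally have wq: "w \<le> q" by simp
    then have w1: "w \<le> 1" using assms by simp
    have "\<bar>(1 + y) / 2\<bar> * w ^ (2 * l) * (\<Prod>j<L. \<bar>1 - (q\<^sup>2) ^ Suc j * w\<^sup>2\<bar>) \<le> 1 * q ^ (2 * l) * 1"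
    proof (intro mult_mono prod_le_1 conjI)
      show "\<bar>(1 + y) / 2\<bar> \<le> 1" using y(1) w1 by (simp add: abs_le_iff; linarith)
      show "\<bar>1 - (q\<^sup>2) ^ Suc j * w\<^sup>2\<bar> \<le> 1" for j
      proof -
        have "w\<^sup>2 \<le> 1" using w w1 by (simp add: power_le_one)
        then have "(q\<^sup>2) ^ Suc j * w\<^sup>2 \<le> 1" "0 \<le> (q\<^sup>2) ^ Suc j * w\<^sup>2"
          using q2[of j] by (auto intro: mult_le_one simp del: power_Suc)
        then show ?thesis by linarith
      qed
    qed (use w wq assms in \<open>auto intro: power_mono prod_nonneg\<close>)
    then show ?thesis unfolding abs_p using rhs by linarith
  next
    case 3
    define j where "j = nat (- m) - 1"
    have j: "j < L" "nat (- m) = Suc j" using 3 by (auto simp: j_def)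
    have "w = inverse (q ^ Suc j)"
      using 3 j by (simp add: w_def power_int_def power_inverse)
    then have "w * q ^ Suc j = 1"
      using assms by (simp del: power_Suc)
    then have "(w * q ^ Suc j)\<^sup>2 = 1" by simp
    then have "(q\<^sup>2) ^ Suc j * w\<^sup>2 = 1"
      by (simp only: power_mult_distrib power_mult[symmetric] mult.commute)
    then have "(\<Prod>j<L. \<bar>1 - (q\<^sup>2) ^ Suc j * w\<^sup>2\<bar>) = 0"
      using j(1) by (intro prod_zero) auto
    then have "\<bar>poly (peak_poly q l L) y\<bar> = 0" by (simp only: abs_p mult_zero_right)
    then show ?thesis using rhs by linarith
  next
    case 4
    have wi: "w = inverse (q ^ nat (- m))"
      using 4 by (simp add: w_def power_int_def power_inverse)
    have w1: "1 \<le> w"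
      unfolding wi using assms by (intro one_le_inverse) (auto intro: power_le_one)
    have "\<bar>(1 + y) / 2\<bar> * w ^ (2 * l) * (\<Prod>j<L. \<bar>1 - (q\<^sup>2) ^ Suc j * w\<^sup>2\<bar>) \<le>
        w * w ^ (2 * l) * (\<Prod>j<L. (q\<^sup>2) ^ Suc j * w\<^sup>2)"
    proof (intro mult_mono prod_mono conjI)
      show "\<bar>(1 + y) / 2\<bar> \<le> w" using y(1) w1 by (simp add: abs_le_iff; linarith)
      show "\<bar>1 - (q\<^sup>2) ^ Suc j * w\<^sup>2\<bar> \<le> (q\<^sup>2) ^ Suc j * w\<^sup>2" if "j \<in> {..<L}" for j
      proof -
        have "q ^ nat (- m) \<le> q ^ Suc j"
          using that 4 assms by (intro power_decreasing) auto
        then have "1 \<le> q ^ Suc j * w"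
          using assms unfolding wi by (simp add: field_simps)
        then have "1 \<le> (q ^ Suc j * w)\<^sup>2" by simp
        then have "1 \<le> (q\<^sup>2) ^ Suc j * w\<^sup>2"
          by (simp only: power_mult_distrib power_mult[symmetric] mult.commute)
        then show ?thesis by linarith
      qed
    qed (use w in \<open>auto intro: prod_nonneg\<close>)
    also have "\<dots> = q ^ (L * Suc L) * w ^ (2 * l + 2 * L + 1)"
    proof -
      have "(\<Prod>j<L. (q\<^sup>2) ^ Suc j) = q ^ (L * Suc L)"
      proof (induction L)
        case (Suc L)
        have "(\<Prod>j<Suc L. (q\<^sup>2) ^ Suc j) = q ^ (L * Suc L + 2 * Suc L)"
          using Suc by (simp only: prod.lessThan_Suc power_add power_mult)
        also have "L * Suc L + 2 * Suc L = Suc L * Suc (Suc L)" by simp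
        finally show ?case .
      qed simp
      then show ?thesis
        unfolding prod.distrib by (simp add: power_add power_mult power2_eq_square mult_ac flip: power_mult_distrib)
    qed
    finally show ?thesis unfolding abs_p using rhs by linarith
  qed
  then show ?thesis by (simp add: y_def w_def)
qed

text \<open>These products are the peak values of \<open>peak_poly\<close>, which therefore do not
  degenerate as L grows.\<close>

lemma prod_tendsto_nonzero:
  assumes "0 < q" "q < (1::real)"
  obtains c where "c \<noteq> 0" "(\<lambda>L. \<Prod>j<L. 1 - (q\<^sup>2) ^ Suc j) \<longlonglongrightarrow> c"
proof -
  have q2: "0 < q\<^sup>2" "q\<^sup>2 < 1"
    using assms by (auto simp: power_less_one_iff)
  have "summable (\<lambda>j. q\<^sup>2 * (q\<^sup>2) ^ j)"
    using q2 by (intro summable_mult summable_geometric) auto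
  then have "abs_convergent_prod (\<lambda>j. 1 - (q\<^sup>2) ^ Suc j)"
    by (simp add: abs_convergent_prod_conv_summable abs_mult)
  then have conv: "convergent_prod (\<lambda>j. 1 - (q\<^sup>2) ^ Suc j)"
    by (rule abs_convergent_prod_imp_convergent_prod)
  have "(q\<^sup>2) ^ Suc j < 1" for j
    using q2 by (intro power_Suc_less_one)
  then have "prodinf (\<lambda>j. 1 - (q\<^sup>2) ^ Suc j) \<noteq> 0"
    using conv by (intro prodinf_nonzero) (auto simp del: power_Suc simp: less_imp_neq)
  moreover have "(\<lambda>L. \<Prod>j<L. 1 - (q\<^sup>2) ^ Suc j) \<longlonglongrightarrow> prodinf (\<lambda>j. 1 - (q\<^sup>2) ^ Suc j)"
    using has_prod_imp_tendsto[OF convergent_prod_has_prod[OF conv]]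
    by (subst (asm) lessThan_Suc_atMost [symmetric]) (rule LIMSEQ_imp_Suc)
  ultimately show ?thesis using that by blast
qed

text \<open>The power e is kept general because a Horner step for p raises it by one.
  \<open>Re\<close> only converts the real lattice point to an argument of a real
  polynomial.\<close>

lemma has_sum_q_integral_term_poly:
  assumes "0 < q" "\<And>e. (q_integral_term q \<gamma> (\<lambda>x. f x * x ^ e) has_sum 0) A"
  shows "(q_integral_term q \<gamma> (\<lambda>x. f x * x ^ e * of_real (poly p (Re x))) has_sum 0) A"
proof (induction p arbitrary: e)
  case 0
  show ?case by (simp add: q_integral_term_def)
next
  case (pCons a p)
  have "q_integral_term q \<gamma> (\<lambda>x. f x * x ^ e * of_real (poly (pCons a p) (Re x))) =
      (\<lambda>t. of_real a * q_integral_term q \<gamma> (\<lambda>x. f x * x ^ e) t +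
        q_integral_term q \<gamma> (\<lambda>x. f x * x ^ Suc e * of_real (poly p (Re x))) t)"
    by (auto simp: q_integral_term_def fun_eq_iff scaleR_conv_of_real simp del: of_real_mult of_real_power)
      (simp add: algebra_simps)
  moreover have "((\<lambda>t. of_real a * q_integral_term q \<gamma> (\<lambda>x. f x * x ^ e) t +
        q_integral_term q \<gamma> (\<lambda>x. f x * x ^ Suc e * of_real (poly p (Re x))) t) has_sum
        of_real a * 0 + 0) A"
    by (intro has_sum_add has_sum_cmult_right assms pCons.IH)
  ultimately show ?case by simp
qed

text \<open>Far out, \<open>peak_poly\<close> contributes the factor \<open>q\<close> to the \<open>L\<^sup>2 + L\<close>, whereas the unscaled moment of
  order \<open>2 L + 2 l + 1\<close> grows like \<open>q\<close> to the \<open>-2 (1 - \<alpha>) L\<^sup>2\<close>; this is where \<open>\<alpha> > 1/2\<close> is needed.\<close>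

lemma q_moments_zero_imp_zero:
  assumes "0 < q" "q < 1" "0 < \<gamma>" and f: "f \<in> I_inf q \<gamma>"
    and \<alpha>: "1/2 < \<alpha>" and "0 < b"
    and growth: "(\<lambda>e. q_abs_moment q \<gamma> f e) \<in> O(\<lambda>e. q powr (\<alpha> * (real e)\<^sup>2 / 2) * b ^ e)"
    and zero: "\<And>e. q_moment q \<gamma> f e = 0"
    and x: "x \<in> q_lattice q \<gamma>"
  shows "f x = 0"
proof -
  define A where "A = (UNIV :: int set) \<times> {1, -1 :: real}"
  define T where "T = (\<lambda>e. q_integral_term q \<gamma> (\<lambda>x. f x * x ^ e))"
  define M where "M = (\<lambda>e. infsum (\<lambda>t. norm (T e t)) A)"
  obtain \<epsilon>0 k0 where x0: "x = of_real (\<epsilon>0 * q powi k0 * \<gamma>)" "\<epsilon>0 \<in> {1, -1}"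
    using x by (auto simp: q_lattice_def)
  define r where "r = q powi k0 * \<gamma>"
  have r: "0 < r" using assms by (simp add: r_def)
  have summ: "(\<lambda>t. norm (T e t)) summable_on A" for e
    using f by (simp add: I_inf_def q_integrable_def T_def A_def)
  have T0: "(T e has_sum 0) A" for e
  proof -
    have "q_integral q \<gamma> (\<lambda>x. f x * x ^ e) = 0"
      using zero[of e] assms by (simp add: q_moment_def)
    then have "infsum (T e) A = 0"
      using assms by (simp add: q_integral_def T_def A_def)
    then show ?thesis
      using abs_summable_summable[OF summ[of e]] by (simp add: has_sum_iff)
  qed
  have key: "norm (T 0 (k0, \<epsilon>0)) * (\<Prod>j<L. 1 - (q\<^sup>2) ^ Suc j) \<le>
      q ^ (2 * l) * M 0 + q ^ (L * Suc L) * inverse r ^ (2 * l + 2 * L + 1) * M (2 * l + 2 * L + 1)"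
    (is "_ \<le> ?B") for l L
  proof -
    define E where "E = 2 * l + 2 * L + 1"
    \<comment> \<open>The rescaling sends the chosen lattice point to 1 and every lattice point to
      some y = \<plusminus>q^m.\<close>
    define p where "p = peak_poly q l L \<circ>\<^sub>p [:0, inverse (\<epsilon>0 * r):]"
    define F where "F = q_integral_term q \<gamma> (\<lambda>x. f x * x ^ 0 * of_real (poly p (Re x)))"
    have F0: "(F has_sum 0) A"
      unfolding F_def using assms(1) T0 unfolding T_def by (rule has_sum_q_integral_term_poly)
    have F: "norm (F (k, \<epsilon>)) = norm (T 0 (k, \<epsilon>)) * \<bar>poly (peak_poly q l L) ((\<epsilon> / \<epsilon>0) * q powi (k - k0))\<bar>"
      for k \<epsilon>
    proof -
      have "poly p (\<epsilon> * q powi k * \<gamma>) = poly (peak_poly q l L) ((\<epsilon> / \<epsilon>0) * q powi (k - k0))"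
        using assms x0 by (simp add: p_def poly_pcompose r_def power_int_diff field_simps)
      then show ?thesis
        unfolding F_def T_def q_integral_term_def prod.case Re_complex_of_real
        by (simp add: norm_mult)
    qed
    have "norm (F t) \<le> q ^ (2 * l) * norm (T 0 t) + q ^ (L * Suc L) * inverse r ^ E * norm (T E t)"
      if tA: "t \<in> A - {(k0, \<epsilon>0)}" for t
    proof -
      obtain k \<epsilon> where t: "t = (k, \<epsilon>)" "\<epsilon> \<in> {1, -1}" using tA by (auto simp: A_def)
      have "\<bar>poly (peak_poly q l L) ((\<epsilon> / \<epsilon>0) * q powi (k - k0))\<bar> \<le>
          q ^ (2 * l) + q ^ (L * Suc L) * (q powi (k - k0)) ^ E"
        unfolding E_def using assms tA t x0(2)
        by (intro abs_poly_peak_poly_le) auto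
      then have "norm (F t) \<le> norm (T 0 t) * (q ^ (2 * l) + q ^ (L * Suc L) * (q powi (k - k0)) ^ E)"
        unfolding t F by (intro mult_left_mono) auto
      \<comment> \<open>Since r q^(k - k0) = |x|, the power in the far-out term turns the summand of
        order 0 into that of order E.\<close>
      moreover have "norm (T E t) = norm (T 0 t) * (r * q powi (k - k0)) ^ E"
      proof -
        have "\<bar>\<epsilon> * q powi k * \<gamma>\<bar> = r * q powi (k - k0)"
          using assms t by (auto simp: r_def power_int_diff abs_mult)
        then show ?thesis
          unfolding T_def q_integral_term_def t prod.case
          by (simp add: norm_mult norm_power del: of_real_mult)
      qed
      ultimately show ?thesis
        using r by (simp add: power_mult_distrib field_simps)
    qed
    note bnd = this
    have t0: "(k0, \<epsilon>0) \<in> A" using x0 by (simp add: A_def)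
    have sumB: "(\<lambda>t. q ^ (2 * l) * norm (T 0 t) + q ^ (L * Suc L) * inverse r ^ E * norm (T E t)) summable_on A"
      by (intro summable_on_add summable_on_cmult_right summ)
    have sumB': "(\<lambda>t. q ^ (2 * l) * norm (T 0 t) + q ^ (L * Suc L) * inverse r ^ E * norm (T E t))
        summable_on (A - {(k0, \<epsilon>0)})"
      using sumB by (rule summable_on_subset_banach) auto
    have absF: "(\<lambda>t. norm (F t)) summable_on (A - {(k0, \<epsilon>0)})"
      using Infinite_Sum.abs_summable_on_comparison_test'[OF sumB' bnd] .
    \<comment> \<open>The total is 0, so the peak term is minus the sum of all others, to which
      \<open>bnd\<close> applies.\<close>
    have "(F has_sum 0 - F (k0, \<epsilon>0)) (A - {(k0, \<epsilon>0)})"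
      using has_sum_Diff[OF F0 has_sum_finite[of "{(k0, \<epsilon>0)}" F]] t0 by simp
    then have "F (k0, \<epsilon>0) = - infsum F (A - {(k0, \<epsilon>0)})"
      by (simp add: has_sum_iff)
    then have "norm (F (k0, \<epsilon>0)) = norm (infsum F (A - {(k0, \<epsilon>0)}))"
      by simp
    also have "\<dots> \<le> infsum (\<lambda>t. norm (F t)) (A - {(k0, \<epsilon>0)})"
      using absF by (rule norm_infsum_bound)
    also have "\<dots> \<le> infsum (\<lambda>t. q ^ (2 * l) * norm (T 0 t) + q ^ (L * Suc L) * inverse r ^ E * norm (T E t)) (A - {(k0, \<epsilon>0)})"
      using absF sumB' bnd by (rule infsum_mono)
    also have "\<dots> \<le> infsum (\<lambda>t. q ^ (2 * l) * norm (T 0 t) + q ^ (L * Suc L) * inverse r ^ E * norm (T E t)) A"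
      using sumB' sumB assms r by (intro infsum_mono2) auto
    also have "\<dots> = ?B"
      unfolding M_def E_def[symmetric]
      by (subst infsum_add) (auto intro!: summable_on_cmult_right summ simp: infsum_cmult_right')
    finally have "norm (F (k0, \<epsilon>0)) \<le> ?B" .
    moreover have "norm (F (k0, \<epsilon>0)) = norm (T 0 (k0, \<epsilon>0)) * \<bar>\<Prod>j<L. 1 - (q\<^sup>2) ^ Suc j\<bar>"
      unfolding F using x0 by (auto simp: poly_peak_poly_1)
    moreover have "norm (T 0 (k0, \<epsilon>0)) * (\<Prod>j<L. 1 - (q\<^sup>2) ^ Suc j) \<le>
        norm (T 0 (k0, \<epsilon>0)) * \<bar>\<Prod>j<L. 1 - (q\<^sup>2) ^ Suc j\<bar>"
      by (intro mult_left_mono) auto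
    ultimately show ?thesis by linarith
  qed
  have lim0: "(\<lambda>L. q ^ (L * Suc L) * inverse r ^ (2 * l + 2 * L + 1) * M (2 * l + 2 * L + 1)) \<longlonglongrightarrow> 0" for l
  proof -
    define E where "E = (\<lambda>L. 2 * l + 2 * L + 1)"
    \<comment> \<open>Writing b / r as a power of q collects the whole bound into a single power of
      q.\<close>
    define s where "s = log q (b * inverse r)"
    have s: "b * inverse r = q powr s"
      using assms r by (simp add: s_def)
    have M0: "0 \<le> M e" for e
      unfolding M_def by (intro infsum_nonneg) simp
    have nu: "q_abs_moment q \<gamma> f e = q powr (((real e)\<^sup>2 + real e) / 2) * ((1 - q) * M e)" for e
    proof -
      have "norm (T e t) = q_integral_term q \<gamma> (\<lambda>x. cmod (f x * x ^ e)) t" for t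
        using assms by (auto simp: T_def q_integral_term_def split: prod.splits)
      moreover have "real ((e\<^sup>2 + e) div 2) = ((real e)\<^sup>2 + real e) / 2"
        by (simp add: real_of_nat_div)
      then have "q ^ ((e\<^sup>2 + e) div 2) = q powr (((real e)\<^sup>2 + real e) / 2)"
        using assms by (metis powr_realpow)
      ultimately show ?thesis
        by (simp add: q_abs_moment_def q_integral_def M_def A_def)
    qed
    obtain C where C: "C > 0" "\<forall>\<^sub>F e in sequentially. norm (q_abs_moment q \<gamma> f e) \<le>
        C * norm (q powr (\<alpha> * (real e)\<^sup>2 / 2) * b ^ e)"
      using growth by (rule landau_o.bigE)
    \<comment> \<open>The exponent is quadratic in L, written in Horner form to match the divergence
      rules. Its leading coefficient is 2 \<alpha> - 1: L^2 from the polynomial and 2 (\<alpha> - 1)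
      L^2 from the moment of order E.\<close>
    define X where "X = (\<lambda>L. ((\<alpha> - 1) * (2 * real l + 1)\<^sup>2 / 2 - (2 * real l + 1) / 2 + s * (2 * real l + 1))
        + real L * ((2 * (\<alpha> - 1) * (2 * real l + 1) + 2 * s) + (2 * \<alpha> - 1) * real L))"
    have bound: "q ^ (L * Suc L) * inverse r ^ E L * M (E L) \<le> C / (1 - q) * q powr (X L)"
      if "norm (q_abs_moment q \<gamma> f (E L)) \<le> C * norm (q powr (\<alpha> * (real (E L))\<^sup>2 / 2) * b ^ E L)" for L
    proof -
      define e where "e = E L"
      have "q powr (((real e)\<^sup>2 + real e) / 2) * ((1 - q) * M e) \<le> C * (q powr (\<alpha> * (real e)\<^sup>2 / 2) * b ^ e)"
        using that assms M0[of e] unfolding nu e_def[symmetric] by (simp add: abs_mult)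
      moreover have "y \<le> C / (1 - q) * (B / A * D)" if "A * ((1 - q) * y) \<le> C * (B * D)" "A > 0"
        for A B D y :: real
        using that assms by (simp add: field_simps)
      ultimately have "M e \<le> C / (1 - q) * (q powr (\<alpha> * (real e)\<^sup>2 / 2 - ((real e)\<^sup>2 + real e) / 2) * b ^ e)"
        unfolding powr_diff using assms by simp
      then have "q ^ (L * Suc L) * inverse r ^ e * M e \<le> q ^ (L * Suc L) * inverse r ^ e *
          (C / (1 - q) * (q powr (\<alpha> * (real e)\<^sup>2 / 2 - ((real e)\<^sup>2 + real e) / 2) * b ^ e))"
        using assms r by (intro mult_left_mono) auto
      also have "\<dots> = C / (1 - q) * (q ^ (L * Suc L) *
          q powr (\<alpha> * (real e)\<^sup>2 / 2 - ((real e)\<^sup>2 + real e) / 2) * (b * inverse r) ^ e)"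
        by (simp add: power_mult_distrib mult_ac)
      also have "q ^ (L * Suc L) * q powr (\<alpha> * (real e)\<^sup>2 / 2 - ((real e)\<^sup>2 + real e) / 2) *
          (b * inverse r) ^ e = q powr (X L)"
      proof -
        have "q ^ (L * Suc L) = q powr (real L * (real L + 1))"
          using assms powr_realpow[of q "L * Suc L"] by (simp add: algebra_simps)
        moreover have "(b * inverse r) ^ e = q powr (s * real e)"
          unfolding s using assms by (simp add: powr_powr flip: powr_realpow)
        moreover have "real L * (real L + 1) + (\<alpha> * (real e)\<^sup>2 / 2 - ((real e)\<^sup>2 + real e) / 2) + s * real e = X L"
          by (simp add: X_def e_def E_def power2_eq_square field_simps)
        ultimately show ?thesis by (simp flip: powr_add)
      qed
      finally show ?thesis by (simp add: e_def)
    qed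
    have "filterlim E at_top sequentially"
      unfolding E_def by (rule filterlim_subseq) (auto simp: strict_mono_def)
    then have ev: "\<forall>\<^sub>F L in sequentially. norm (q ^ (L * Suc L) * inverse r ^ E L * M (E L)) \<le> C / (1 - q) * q powr (X L)"
    proof (rule eventually_mono[OF eventually_compose_filterlim[OF C(2)]])
      fix L assume "norm (q_abs_moment q \<gamma> f (E L)) \<le> C * norm (q powr (\<alpha> * (real (E L))\<^sup>2 / 2) * b ^ E L)"
      from bound[OF this] show "norm (q ^ (L * Suc L) * inverse r ^ E L * M (E L)) \<le> C / (1 - q) * q powr (X L)"
        using M0[of "E L"] assms r by (simp add: abs_mult)
    qed
    have "filterlim X at_top sequentially"
      unfolding X_def using \<alpha>
      by (intro filterlim_tendsto_add_at_top[OF tendsto_const]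
        filterlim_at_top_mult_at_top filterlim_real_sequentially
        filterlim_tendsto_pos_mult_at_top[OF tendsto_const]) auto
    then have "(\<lambda>L. exp (ln q * X L)) \<longlonglongrightarrow> 0"
      using assms by (intro filterlim_compose[OF exp_at_bot] filterlim_tendsto_neg_mult_at_bot[OF tendsto_const]) auto
    then have "(\<lambda>L. q powr (X L)) \<longlonglongrightarrow> 0"
      using assms by (simp add: powr_def mult.commute)
    then have "(\<lambda>L. C / (1 - q) * q powr (X L)) \<longlonglongrightarrow> 0"
      by (rule tendsto_mult_right_zero)
    from Lim_null_comparison[OF ev this] show ?thesis
      by (simp add: E_def)
  qed
  obtain c where c: "c \<noteq> 0" "(\<lambda>L. \<Prod>j<L. 1 - (q\<^sup>2) ^ Suc j) \<longlonglongrightarrow> c"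
    using prod_tendsto_nonzero[OF assms(1,2)] .
  have "0 \<le> c"
  proof (rule LIMSEQ_le_const[OF c(2)])
    have "(q\<^sup>2) ^ Suc j \<le> 1" for j
      using assms by (intro power_le_one) auto
    then show "\<exists>N. \<forall>n\<ge>N. 0 \<le> (\<Prod>j<n. 1 - (q\<^sup>2) ^ Suc j)"
      by (auto intro!: prod_nonneg simp del: power_Suc)
  qed
  \<comment> \<open>The limits are taken in order: L to infinity for fixed l removes the far points,
    then l to infinity removes the near ones.\<close>
  have "norm (T 0 (k0, \<epsilon>0)) * c \<le> q ^ (2 * l) * M 0 + 0" for l
    by (rule LIMSEQ_le[OF tendsto_mult[OF tendsto_const c(2)] tendsto_add[OF tendsto_const lim0]])
      (use key in blast)
  moreover have "(\<lambda>l. q ^ (2 * l) * M 0 + 0) \<longlonglongrightarrow> 0 * M 0 + 0"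
    unfolding power_mult using assms
    by (intro tendsto_intros LIMSEQ_power_zero) (auto simp: power_less_one_iff abs_square_less_1)
  ultimately have "norm (T 0 (k0, \<epsilon>0)) * c \<le> 0"
    by (metis (no_types, lifting) LIMSEQ_le_const mult_zero_left add_0)
  then have "T 0 (k0, \<epsilon>0) = 0"
    using c \<open>0 \<le> c\<close> by (simp add: mult_le_0_iff)
  then show ?thesis
    using assms by (simp add: T_def q_integral_term_def x0)
qed

section \<open>Holomorphic series, and the convolution of the q-Gaussian with an entire
  function\<close>

lemma holomorphic_suminf:
  assumes t: "\<And>e. t e holomorphic_on UNIV"
    and M: "\<And>e z. z \<in> cball 0 r \<Longrightarrow> norm (t e z) \<le> M e" "summable M"
  shows "(\<lambda>z. \<Sum>e. t e z) holomorphic_on ball (0::complex) r"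
proof (rule holomorphic_uniform_sequence)
  show "(\<lambda>z. \<Sum>e<n. t e z) holomorphic_on ball 0 r" for n
    by (intro holomorphic_intros holomorphic_on_subset[OF t]) auto
  have "uniform_limit (cball 0 r) (\<lambda>n z. \<Sum>e<n. t e z) (\<lambda>z. \<Sum>e. t e z) sequentially"
    using M by (rule Weierstrass_m_test)
  then show "\<exists>d>0. cball x d \<subseteq> ball 0 r \<and>
      uniform_limit (cball x d) (\<lambda>n z. \<Sum>e<n. t e z) (\<lambda>z. \<Sum>e. t e z) sequentially"
    if "x \<in> ball 0 r" for x
    using that open_contains_cball[of "ball (0::complex) r"] ball_subset_cball[of 0 r]
    by (meson open_ball order_trans uniform_limit_on_subset)
qed auto

lemma zero_islimpt_q_lattice:
  assumes "0 < q" "q < 1" "0 < \<gamma>" "0 < r"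
  shows "0 islimpt (q_lattice q \<gamma> \<inter> ball 0 r)"
proof -
  have "\<exists>x'\<in>q_lattice q \<gamma> \<inter> ball 0 r. x' \<noteq> 0 \<and> dist x' 0 < e" if "e > 0" for e
  proof -
    have "0 < min e r / \<gamma>" using assms that by simp
    then obtain n where n: "q ^ n < min e r / \<gamma>"
      using real_arch_pow_inv[of "min e r / \<gamma>" q] assms by blast
    define x where "x = complex_of_real (1 * q powi (int n) * \<gamma>)"
    have "x \<in> q_lattice q \<gamma>" unfolding x_def q_lattice_def by blast
    moreover have "cmod x < min e r"
      using n assms by (simp add: x_def norm_mult norm_power field_simps)
    moreover have "x \<noteq> 0" using assms by (simp add: x_def)
    ultimately show ?thesis by (intro bexI[of _ x]) auto
  qed
  then show ?thesis by (simp add: islimpt_approachable)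
qed

text \<open>The terms are O of the e-th power of q^(\<alpha> e/2) |b K|, whose base tends to 0 and
  is eventually below 1/2.\<close>

lemma summable_q_gaussian_power:
  assumes "0 < q" "q < 1" "0 < \<alpha>"
    and bigo: "a \<in> O(\<lambda>e. q powr (\<alpha> * (real e)\<^sup>2 / 2) * b ^ e)"
  shows "summable (\<lambda>e. norm (a e) * K ^ e)"
proof -
  obtain C where C: "C > 0" "\<forall>\<^sub>F e in sequentially. norm (a e) \<le>
      C * norm (q powr (\<alpha> * (real e)\<^sup>2 / 2) * b ^ e)"
    using bigo by (rule landau_o.bigE)
  define k where "k = \<bar>b\<bar> * \<bar>K\<bar>"
  have "filterlim (\<lambda>e. \<alpha> / 2 * real e) at_top sequentially"
    using assms by (intro filterlim_tendsto_pos_mult_at_top[OF tendsto_const] filterlim_real_sequentially) auto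
  then have "(\<lambda>e. exp (ln q * (\<alpha> / 2 * real e))) \<longlonglongrightarrow> 0"
    using assms by (intro filterlim_compose[OF exp_at_bot] filterlim_tendsto_neg_mult_at_bot[OF tendsto_const]) auto
  then have "(\<lambda>e. q powr (\<alpha> / 2 * real e)) \<longlonglongrightarrow> 0"
    using assms by (simp add: powr_def mult.commute)
  then have "(\<lambda>e. q powr (\<alpha> / 2 * real e) * k) \<longlonglongrightarrow> 0"
    by (rule tendsto_mult_left_zero)
  then have "\<forall>\<^sub>F e in sequentially. q powr (\<alpha> / 2 * real e) * k < 1/2"
    by (rule order_tendstoD) simp
  with C(2) have "\<forall>\<^sub>F e in sequentially. norm (norm (a e) * K ^ e) \<le> C * (1/2) ^ e"
  proof eventually_elim
    case (elim e)
    have "q powr (\<alpha> * (real e)\<^sup>2 / 2) = (q powr (\<alpha> / 2 * real e)) ^ e"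
      using assms by (simp add: powr_powr power2_eq_square mult_ac flip: powr_realpow)
    then have "norm (q powr (\<alpha> * (real e)\<^sup>2 / 2) * b ^ e) * \<bar>K\<bar> ^ e = (q powr (\<alpha> / 2 * real e) * k) ^ e"
      using assms by (simp add: abs_mult power_abs k_def power_mult_distrib)
    also have "\<dots> \<le> (1/2) ^ e"
      using elim(2) by (intro power_mono) (auto simp: k_def)
    finally have "C * (norm (q powr (\<alpha> * (real e)\<^sup>2 / 2) * b ^ e) * \<bar>K\<bar> ^ e) \<le> C * (1/2) ^ e"
      using C(1) by (intro mult_left_mono) auto
    moreover have "norm (a e) * \<bar>K\<bar> ^ e \<le> C * norm (q powr (\<alpha> * (real e)\<^sup>2 / 2) * b ^ e) * \<bar>K\<bar> ^ e"
      by (intro mult_right_mono elim(1)) auto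
    ultimately show ?case by (simp add: abs_mult power_abs mult.assoc)
  qed
  then show ?thesis
    by (rule summable_comparison_test_ev) (intro summable_mult summable_geometric, auto)
qed

lemma powser_eventually_nonzero:
  fixes c :: "nat \<Rightarrow> complex"
  assumes c: "c m \<noteq> 0" and summ: "\<And>z. summable (\<lambda>e. c e * z ^ e)"
  obtains s where "0 < s" "\<And>z. z \<noteq> 0 \<Longrightarrow> norm z \<le> s \<Longrightarrow> (\<Sum>e. c e * z ^ e) \<noteq> 0"
proof -
  \<comment> \<open>\<open>powser_0_nonzero\<close> isolates a zero at the centre. The extra factor
    z makes 0 a zero whether or not \<open>c 0\<close> vanishes.\<close>
  define a where "a = (\<lambda>n. case n of 0 \<Rightarrow> 0 | Suc e \<Rightarrow> c e)"
  define f where "f = (\<lambda>z. z * (\<Sum>e. c e * z ^ e))"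
  have sums: "(\<lambda>n. a n * (z - 0) ^ n) sums f z" for z
  proof -
    have "(\<lambda>e. z * (c e * z ^ e)) sums f z"
      unfolding f_def by (intro sums_mult summable_sums summ)
    then have "(\<lambda>e. a (Suc e) * (z - 0) ^ Suc e) sums f z"
      by (simp add: a_def mult_ac)
    then show ?thesis
      using sums_Suc_iff[of "\<lambda>n. a n * (z - 0) ^ n"] by (simp add: a_def)
  qed
  have "a (Suc m) \<noteq> 0" using c by (simp add: a_def)
  then obtain s where "0 < s" "\<And>z. z \<in> cball 0 s - {0} \<Longrightarrow> f z \<noteq> 0"
    using powser_0_nonzero[of 1 0 a f "Suc m"] sums by (auto simp: f_def)
  then show ?thesis
    using that[of s] by (auto simp: f_def)
qed

text \<open>Iterating the maximum-modulus bound for \<open>\<partial>\<close> on one disc loses no radius, and on a large disc each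
  application of \<open>\<partial>\<close> at least halves the bound.\<close>

lemma holomorphic_q_conv_gauss:
  assumes q: "0 < q" "q < 1" and \<gamma>: "0 < \<gamma>" and h: "h holomorphic_on UNIV" and R: "0 < R"
  defines "g \<equiv> \<lambda>x. q_exp (q\<^sup>2) (- x\<^sup>2)"
  shows "q_conv q \<gamma> g h holomorphic_on ball 0 R"
    and "\<And>x. cmod x \<le> R \<Longrightarrow> q_conv_converges q \<gamma> g h x"
proof -
  obtain A where A: "\<And>e. q_abs_moment q \<gamma> g e \<le> A"
    using q_abs_moment_gauss_bounded[OF q \<gamma>] unfolding g_def by blast
  have mu: "cmod (q_moment q \<gamma> g e) \<le> A" for e
    using norm_q_moment_le[OF q \<gamma> q_integrable_gauss[OF q \<gamma>, of e]] A[of e] unfolding g_def by linarith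
  have A0: "0 \<le> A" using mu[of 0] norm_ge_zero order_trans by blast
  \<comment> \<open>Chosen so that the disc contains that of radius R and 2 / ((1 - q) r) \<le>
    1/2.\<close>
  define r where "r = R + 4 / (1 - q)"
  have r: "0 < r" "R \<le> r" "4 / (1 - q) \<le> r" using q R by (auto simp: r_def add_pos_pos)
  have "continuous_on (cball 0 r) h"
    by (intro holomorphic_on_imp_continuous_on holomorphic_on_subset[OF h]) auto
  then have "bounded (h ` cball 0 r)"
    by (intro compact_imp_bounded compact_continuous_image) auto
  then obtain B where B: "\<And>z. z \<in> cball 0 r \<Longrightarrow> cmod (h z) \<le> B"
    by (meson bounded_iff imageI)
  have B0: "0 \<le> B" using B[of 0] r norm_ge_zero order_trans by (metis centre_in_cball less_imp_le)
  have bound: "cmod (q_conv_term q \<gamma> g h z e) \<le> A * B * (1/2) ^ e" if "z \<in> cball 0 R" for z e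
  proof -
    have "2 / ((1 - q) * r) \<le> 1/2"
      using r q by (simp add: field_simps)
    then have "(2 / ((1 - q) * r)) ^ e \<le> (1/2) ^ e"
      using r q by (intro power_mono) auto
    moreover have "cmod ((q_deriv q ^^ e) h z) \<le> (2 / ((1 - q) * r)) ^ e * B"
      using that r by (intro norm_q_deriv_funpow_le[OF q r(1) h B]) auto
    ultimately have "cmod ((q_deriv q ^^ e) h z) \<le> (1/2) ^ e * B"
      using B0 by (meson mult_right_mono order_trans)
    moreover have "cmod (q_moment q \<gamma> g e) / q_fact q e \<le> A"
    proof -
      have "cmod (q_moment q \<gamma> g e) / q_fact q e \<le> cmod (q_moment q \<gamma> g e) / 1"
        using q_fact_ge_1[OF q, of e] by (intro divide_left_mono) auto
      then show ?thesis using mu[of e] by simp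
    qed
    ultimately have "cmod (q_moment q \<gamma> g e) / q_fact q e * cmod ((q_deriv q ^^ e) h z) \<le> A * ((1/2) ^ e * B)"
      using A0 by (intro mult_mono) auto
    then show ?thesis
      using q_fact_ge_1[OF q, of e]
      by (simp add: q_conv_term_def norm_mult norm_divide norm_power mult_ac)
  qed
  have summ: "summable (\<lambda>e. A * B * (1/2) ^ e)"
    by (intro summable_mult summable_geometric) auto
  have "(\<lambda>z. \<Sum>e. q_conv_term q \<gamma> g h z e) holomorphic_on ball 0 R"
  proof (rule holomorphic_suminf[OF _ bound summ])
    show "(\<lambda>z. q_conv_term q \<gamma> g h z e) holomorphic_on UNIV" for e
      unfolding q_conv_term_def using q_fact_ge_1[OF q, of e]
      by (intro holomorphic_intros holomorphic_q_deriv_funpow q h) auto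
  qed
  then show "q_conv q \<gamma> g h holomorphic_on ball 0 R"
    by (simp add: q_conv_def[abs_def])
  show "q_conv_converges q \<gamma> g h x" if "cmod x \<le> R" for x
    unfolding q_conv_converges_def
    by (rule summable_comparison_test'[OF summ]) (use bound[of x] that in auto)
qed

section \<open>Comparison of the two convolutions at the pole \<i>\<close>

theorem theorem6p5:
  fixes q \<gamma> :: real and f g :: "complex \<Rightarrow> complex"
  assumes "0 < q" "q < 1" and "\<gamma> > 0"
    and "g = (\<lambda>x. q_exp (q\<^sup>2) (- x\<^sup>2))"
    and "f \<in> HS_I_gt_half q \<gamma>"
    and "f holomorphic_on UNIV"
    and "\<exists>x. f x \<noteq> 0"
  shows "\<exists>N::int. \<forall>n\<ge>N. q_conv_differ q \<gamma> (q_dil q (-n) f) g"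
proof -
  note q = \<open>0 < q\<close> \<open>q < 1\<close> and \<gamma> = \<open>\<gamma> > 0\<close> and g = \<open>g = _\<close> and hol = \<open>f holomorphic_on UNIV\<close>
  have q2: "0 < q\<^sup>2" "q\<^sup>2 < 1"
    using q by (auto simp: power_less_one_iff)
  obtain \<alpha> b where fI: "f \<in> I_inf q \<gamma>" and \<alpha>: "1/2 < \<alpha>" and b: "0 < b"
    and growth: "(\<lambda>e. q_abs_moment q \<gamma> f e) \<in> O(\<lambda>e. q powr (\<alpha> * (real e)\<^sup>2 / 2) * b ^ e)"
    using assms(5) unfolding HS_I_gt_half_def by blast
  \<comment> \<open>The power of 1 - q from \<open>q_deriv_funpow_gauss\<close> is absorbed here, so
    that P becomes the sum of d_e t^e G_e with t = q^n; d itself does not depend on n.\<close>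
  define d where "d = (\<lambda>e. (-1) ^ e * q_moment q \<gamma> f e / of_real (q_fact q e) / (1 - of_real q) ^ e)"
  have d_summable: "summable (\<lambda>e. cmod (d e) * K ^ e)" if "K \<ge> 0" for K
  proof (rule summable_comparison_test')
    show "summable (\<lambda>e. norm (q_abs_moment q \<gamma> f e) * (K / (1 - q)) ^ e)"
      using q \<alpha> growth by (intro summable_q_gaussian_power) auto
    fix e
    have "cmod (1 - of_real q) = 1 - q"
      using q by (metis abs_of_pos diff_gt_0_iff_gt norm_of_real of_real_1 of_real_diff)
    then have "norm (cmod (d e) * K ^ e) = cmod (q_moment q \<gamma> f e) / q_fact q e * (K / (1 - q)) ^ e"
      using that q q_fact_ge_1[OF q, of e]
      by (simp add: d_def norm_mult norm_divide norm_power power_divide abs_mult)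
    also have "\<dots> \<le> norm (q_abs_moment q \<gamma> f e) * (K / (1 - q)) ^ e"
    proof (rule mult_right_mono)
      have "cmod (q_moment q \<gamma> f e) / q_fact q e \<le> cmod (q_moment q \<gamma> f e) / 1"
        using q_fact_ge_1[OF q, of e] by (intro divide_left_mono) auto
      also have "\<dots> \<le> q_abs_moment q \<gamma> f e"
        using norm_q_moment_le[OF q \<gamma>, of f e] fI by (simp add: I_inf_def)
      finally show "cmod (q_moment q \<gamma> f e) / q_fact q e \<le> norm (q_abs_moment q \<gamma> f e)" by simp
    qed (use q that in auto)
    finally show "norm (cmod (d e) * K ^ e) \<le> norm (q_abs_moment q \<gamma> f e) * (K / (1 - q)) ^ e" .
  qed
  obtain e0 where e0: "d e0 \<noteq> 0"
  proof -
    have "\<exists>e. q_moment q \<gamma> f e \<noteq> 0"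
    proof (rule ccontr)
      assume "\<not> ?thesis"
      then have "f x = 0" if "x \<in> q_lattice q \<gamma>" for x
        using q_moments_zero_imp_zero[OF q \<gamma> fI \<alpha> b growth _ that] by blast
      moreover have "0 islimpt q_lattice q \<gamma>"
        using zero_islimpt_q_lattice[OF q \<gamma>, of 1] by (auto intro: islimpt_subset)
      ultimately have "f x = 0" for x
        using analytic_continuation[OF hol open_UNIV connected_UNIV, of "q_lattice q \<gamma>" 0 x] by auto
      with assms(7) show False by blast
    qed
    then obtain e where "q_moment q \<gamma> f e \<noteq> 0" by blast
    moreover have "1 - complex_of_real q \<noteq> 0" using q by auto
    ultimately have "d e \<noteq> 0" using q_fact_ge_1[OF q, of e] by (auto simp: d_def)
    then show ?thesis using that by blast
  qed
  have nonzero: "d e0 * (- \<i>) ^ e0 \<noteq> 0" using e0 by simp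
  have "summable (\<lambda>e. (d e * (- \<i>) ^ e) * z ^ e)" for z
  proof (rule summable_norm_cancel)
    show "summable (\<lambda>e. norm ((d e * (- \<i>) ^ e) * z ^ e))"
      using d_summable[of "cmod z"] by (simp add: norm_mult norm_power)
  qed
  from powser_eventually_nonzero[of "\<lambda>e. d e * (- \<i>) ^ e" e0, OF nonzero this]
  obtain s where s: "0 < s"
      "\<And>z. z \<noteq> 0 \<Longrightarrow> norm z \<le> s \<Longrightarrow> (\<Sum>e. (d e * (- \<i>) ^ e) * z ^ e) \<noteq> 0"
    by metis
  \<comment> \<open>For n \<ge> N the value t = q^n is a nonzero point of the disc where the power
    series has no zero except possibly 0.\<close>
  obtain N :: nat where N: "q ^ N < s"
    using real_arch_pow_inv[OF s(1) q(2)] by blast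
  have "q_conv_differ q \<gamma> (q_dil q (- n) f) g" if n: "int N \<le> n" for n
  proof (rule ccontr)
    assume not_differ: "\<not> ?thesis"
    define t where "t = q powi n"
    define h where "h = q_dil q (- n) f"
    have t: "0 < t" "t \<le> s"
    proof -
      show "0 < t" using q by (simp add: t_def)
      have "t = q ^ nat n" using n by (simp add: t_def power_int_def)
      also have "\<dots> \<le> q ^ N" using n q by (intro power_decreasing) auto
      finally show "t \<le> s" using N by simp
    qed
    have h: "h holomorphic_on UNIV"
      using holomorphic_on_compose_gen[OF _ hol, of "\<lambda>z. of_real (q powi (- n)) * z" UNIV]
      by (auto simp: o_def h_def q_dil_def[abs_def] intro!: holomorphic_intros)
    define P where "P = (\<lambda>z. \<Sum>e. d e * of_real t ^ e * gauss_poly q e z)"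
    \<comment> \<open>The constant 3 is 1 + |z| for |z| \<le> 2.\<close>
    have bound: "cmod (d e * of_real t ^ e * gauss_poly q e z) \<le> cmod (d e) * (3 * t) ^ e"
      if "z \<in> cball 0 2" for z e
    proof -
      have "cmod (gauss_poly q e z) \<le> (1 + cmod z) ^ e"
        by (rule norm_gauss_poly_le) fact+
      also have "\<dots> \<le> 3 ^ e"
        using that by (intro power_mono) auto
      finally have "cmod (d e) * t ^ e * cmod (gauss_poly q e z) \<le> cmod (d e) * t ^ e * 3 ^ e"
        using t by (intro mult_left_mono) auto
      then show ?thesis
        using t by (simp add: norm_mult norm_power power_mult_distrib mult_ac)
    qed
    have summ: "summable (\<lambda>e. cmod (d e) * (3 * t) ^ e)"
      using t by (intro d_summable) auto
    have P: "P holomorphic_on ball 0 2"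
      unfolding P_def
      by (rule holomorphic_suminf[OF _ bound summ]) (intro holomorphic_intros holomorphic_gauss_poly)
    have conv_left: "q_conv_converges q \<gamma> h g x \<and> q_conv q \<gamma> h g x = of_real t * g x * P x"
      if xL: "x \<in> q_lattice q \<gamma> \<inter> ball 0 2" for x
    proof -
      obtain \<epsilon> k where "x = of_real (\<epsilon> * q powi k * \<gamma>)" "\<epsilon> \<in> {1, -1}"
        using xL unfolding q_lattice_def by blast
      then obtain y where y: "x = of_real y" "y \<noteq> 0"
        using q \<gamma> by fastforce
      \<comment> \<open>Dilation contributes t^(e+1), whence the prefactor t beside t^e.\<close>
      have term_eq: "q_conv_term q \<gamma> h g x e = of_real t * g x * (d e * of_real t ^ e * gauss_poly q e x)" for e
        using q_deriv_funpow_gauss[OF q y(2), of e] unfolding y g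
        by (simp add: q_conv_term_def h_def q_moment_dilate[OF q(1)] t_def d_def)
      have abs_summable: "summable (\<lambda>e. norm (d e * of_real t ^ e * gauss_poly q e x))"
        by (rule summable_comparison_test'[OF summ]) (use bound[of x] that in auto)
      have "q_conv_converges q \<gamma> h g x"
        unfolding q_conv_converges_def term_eq norm_mult[of "of_real t * g x"]
        by (intro summable_mult abs_summable)
      moreover have "q_conv q \<gamma> h g x = of_real t * g x * P x"
        unfolding q_conv_def term_eq P_def by (rule suminf_mult[OF summable_norm_cancel[OF abs_summable]])
      ultimately show ?thesis ..
    qed
    define E where "E = q_conv q \<gamma> g h"
    have E: "E holomorphic_on ball 0 2" "\<And>x. cmod x \<le> 2 \<Longrightarrow> q_conv_converges q \<gamma> g h x"
      unfolding E_def g by (rule holomorphic_q_conv_gauss; use q \<gamma> h in simp)+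
    define \<phi> where "\<phi> = (\<lambda>z. q_poch_inf (- z\<^sup>2) (q\<^sup>2))"
    have \<phi>: "\<phi> holomorphic_on ball 0 2"
    proof -
      have "(\<lambda>z. - z\<^sup>2) holomorphic_on ball (0::complex) 2"
        by (intro holomorphic_intros)
      from holomorphic_on_compose_gen[OF this holomorphic_q_poch_inf[OF q2]] show ?thesis
        by (simp add: o_def \<phi>_def)
    qed
    have eq: "of_real t * P x - E x * \<phi> x = 0" if xL: "x \<in> q_lattice q \<gamma> \<inter> ball 0 2" for x
    proof -
      \<comment> \<open>Equality may be concluded only because both series converge absolutely at x:
        \<open>q_conv_differ\<close> requires this of a point of difference.\<close>
      have "of_real t * g x * P x = E x"
        using not_differ conv_left[OF that] E(2)[of x] that
        by (auto simp: q_conv_differ_def h_def E_def)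
      moreover have "\<phi> x \<noteq> 0"
      proof -
        obtain y where "x = of_real y" using xL unfolding q_lattice_def by blast
        then show ?thesis
          using norm_q_poch_inf_ge_1[OF q2, of "- y\<^sup>2"] by (auto simp: \<phi>_def)
      qed
      ultimately show ?thesis
        by (simp add: g q_exp_def \<phi>_def field_simps)
    qed
    \<comment> \<open>Both g and its pole have been cleared by multiplying with
      \<open>\<phi>\<close>, so the identity extends from the lattice near 0 to \<i>.\<close>
    have "of_real t * P \<i> - E \<i> * \<phi> \<i> = 0"
      by (rule analytic_continuation[of _ "ball 0 2" "q_lattice q \<gamma> \<inter> ball 0 2" 0])
        (use zero_islimpt_q_lattice[OF q \<gamma>] eq in \<open>auto intro!: holomorphic_intros P E \<phi>\<close>)
    moreover have "\<phi> \<i> = 0"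
      using q_poch_inf_1[OF q2] by (simp add: \<phi>_def)
    ultimately have "P \<i> = 0" using t by simp
    moreover have "P \<i> = (\<Sum>e. (d e * (- \<i>) ^ e) * of_real t ^ e)"
      by (simp add: P_def gauss_poly_ii mult_ac)
    moreover have "(\<Sum>e. (d e * (- \<i>) ^ e) * of_real t ^ e) \<noteq> 0"
      using t by (intro s(2)) auto
    ultimately show False by simp
  qed
  then show ?thesis by blast
qed

end
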